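(* The Dirichlet series $$g(s)=\sum_{n=2}^\infty\frac{1}{n\log n}\,n^{-s}$$ is in $\mathrm{BMOA}(\mathbb{C}_0)$.
   Context: $\mathbb{C}_0=\{s:\mathrm{Re}\,s>0\}$. $\mathrm{BMOA}(\mathbb{C}_0)$ consists of the holomorphic functions $g$ in $\mathbb{C}_0$ (Poisson integrals of their boundary values $g(it)$) with $$\|g\|_{\mathrm{BMO}(\mathbb{C}_0)}=\sup_{I\subset\mathbb{R}}\frac1{|I|}\int_I\Big|g(it)-\frac1{|I|}\int_Ig(i\tau)\,d\tau\Big|\,dt<\infty,$$ the supremum being over bounded intervals $I$. *)

theory Defs
  imports "HOL-Analysis.Analysis" "HOL-Complex_Analysis.Complex_Analysis"
begin

definition right_half_plane :: "complex set" where
  "right_half_plane = {s. Re s > 0}"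

definition stolz_region :: "real \<Rightarrow> real \<Rightarrow> complex set" where
  "stolz_region \<alpha> t = {s. Re s > 0 \<and> \<bar>Im s - t\<bar> < \<alpha> * Re s}"

definition has_nontangential_limit :: "(complex \<Rightarrow> complex) \<Rightarrow> real \<Rightarrow> complex \<Rightarrow> bool" where
  "has_nontangential_limit g t l \<longleftrightarrow>
     (\<forall>\<alpha>>0. (g \<longlongrightarrow> l) (at (Complex 0 t) within stolz_region \<alpha> t))"

text \<open>The boundary value written g(it) on paper.  Only the values of \<open>g\<close> in the open half-plane
  enter, and the result is meaningful only where the nontangential limit exists (membership in
  \<open>BMOA\<close> below asks for this almost everywhere).\<close>

definition boundary_value :: "(complex \<Rightarrow> complex) \<Rightarrow> real \<Rightarrow> complex" where
  "boundary_value g t = (THE l. has_nontangential_limit g t l)"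

definition poisson_kernel :: "real \<Rightarrow> real \<Rightarrow> real" where
  "poisson_kernel \<sigma> t = \<sigma> / (pi * (\<sigma>\<^sup>2 + t\<^sup>2))"

definition interval_mean :: "(real \<Rightarrow> complex) \<Rightarrow> real \<Rightarrow> real \<Rightarrow> complex" where
  "interval_mean f a b = (1 / (b - a)) *\<^sub>R (LINT t:{a..b}|lborel. f t)"

text \<open>The supremum is taken in the extended nonnegative reals, so that an infinite mean
  oscillation is not lost.  If a measurable \<open>f\<close> fails to be integrable on some interval, its
  Bochner integral there is 0 by convention, but the mean oscillation over that interval is then
  infinite.\<close>

definition bmo_norm :: "(real \<Rightarrow> complex) \<Rightarrow> ennreal" where
  "bmo_norm f = (SUP (a, b) \<in> {(a, b). a < b}.
     ennreal (1 / (b - a)) *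
     (\<integral>\<^sup>+ t\<in>{a..b}. ennreal (norm (f t - interval_mean f a b)) \<partial>lborel))"

text \<open>The \<open>has_bochner_integral\<close> condition includes absolute convergence of the Poisson integral;
  since the kernel is positive and bounded below on bounded intervals, it also makes the boundary
  function measurable and locally integrable.\<close>

definition BMOA :: "(complex \<Rightarrow> complex) set" where
  "BMOA = {g. g holomorphic_on right_half_plane \<and>
     (AE t in lborel. \<exists>l. has_nontangential_limit g t l) \<and>
     (\<forall>s\<in>right_half_plane.
        has_bochner_integral lborel
          (\<lambda>t. poisson_kernel (Re s) (Im s - t) *\<^sub>R boundary_value g t) (g s)) \<and>
     bmo_norm (boundary_value g) < \<infinity>}"

end

theory Submission
  imports Defs "HOL-Real_Asymp.Real_Asymp"
begin

text \<open>Since the coefficients are nonnegative, the mean oscillation over an interval of length \<open>l\<close> can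
  be read off from the splitting of the series at \<open>l * ln n = 1\<close>. The derivative of the low part is
  bounded by the sum of \<open>1 / n\<close> over \<open>ln n \<le> 1 / l\<close>, which is at most \<open>1 / l\<close>. The high part is
  bounded in mean square: integrating its square against a window of width \<open>l\<close> leaves the form with
  kernel \<open>1 / (1 + l\<^sup>2 * (ln m - ln n)\<^sup>2)\<close>, and Schur's test with \<open>1 / (n * (ln n)\<^sup>2)\<close> bounds it by
  a multiple of \<open>l\<close>.

  Boundary values come from comparing \<open>1 / s\<close> with the sum of \<open>n powr (-1 - s)\<close>: adding \<open>Ln s\<close> to
  the series gives a function that is Lipschitz on bounded parts of the half-plane. The constants
  grow only like \<open>sqrt (norm s)\<close>, which is integrable against the Poisson kernel, so dominated
  convergence applies to the Poisson integrals over the lines \<open>Re s = \<epsilon>\<close> as \<open>\<epsilon>\<close> tends to 0.\<close>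

subsection \<open>Sums over logarithmic frequencies\<close>

text \<open>The coefficients \<open>1 / (n * ln n)\<close> are not summable, so the tail of the
  series on the imaginary axis cannot be bounded term by term. The oscillation estimates are
  therefore made for finite sums with any coefficients
  \<open>0 \<le> b n \<le> 1 / (n * ln n)\<close>. This class contains
  \<open>n powr (-1 - \<epsilon>) / ln n\<close> for every \<open>\<epsilon> \<ge> 0\<close>, the
  bounds do not depend on \<open>\<epsilon>\<close>, and Fatou's lemma carries them to the boundary.
  For short intervals the cut at \<open>l * ln n = 1\<close> balances Schur's test: beyond it the
  weights sum to order \<open>l\<close>, the rows of the kernel to order \<open>1 / l\<close>, and
  the product is bounded; for long ones both are bounded. The factor \<open>l\<close> that remains
  is the length of the window.

  The derivative of the series is 1 - zeta(1 + s), with a simple pole at 0; hence the comparison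
  with \<open>1 / s\<close> and the logarithm. Comparing each \<open>n powr (-1 - s)\<close> with an
  integral costs a factor \<open>norm s\<close> in the obvious estimate, and linear growth is not
  integrable against the Poisson kernel. Interpolation with a trivial bound reduces the cost to a
  square root.\<close>

lemma sum_le_of_increments:
  fixes f G :: "nat \<Rightarrow> real"
  assumes "finite A" "A \<subseteq> {k..}"
    and incr: "\<And>n. n \<in> A \<Longrightarrow> f n \<le> G (Suc n) - G n"
    and mono: "\<And>n. k \<le> n \<Longrightarrow> G n \<le> G (Suc n)"
    and up: "\<And>n. k \<le> n \<Longrightarrow> G n \<le> B" and low: "D \<le> G k"
  shows "sum f A \<le> B - D"
proof -
  obtain N where N: "A \<subseteq> {k..<N}" "k \<le> N"
  proof -
    obtain M where "\<forall>n\<in>A. n \<le> M"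
      using \<open>finite A\<close> finite_nat_set_iff_bounded_le by blast
    with \<open>A \<subseteq> {k..}\<close> show ?thesis
      by (intro that[of "Suc (max M k)"]) (auto simp: less_Suc_eq_le le_max_iff_disj)
  qed
  have "sum f A \<le> (\<Sum>n\<in>A. G (Suc n) - G n)"
    by (rule sum_mono) (rule incr)
  \<comment> \<open>Gaps in \<open>A\<close> are filled with nonnegative increments, so the sum
    telescopes although \<open>f\<close> is controlled only on \<open>A\<close>.\<close>
  also have "\<dots> \<le> (\<Sum>n=k..<N. G (Suc n) - G n)"
    using N mono by (intro sum_mono2) auto
  also have "\<dots> = G N - G k"
    using N by (intro sum_Suc_diff') auto
  also have "\<dots> \<le> B - D"
    using up[OF N(2)] low by simp
  finally show ?thesis .
qed

lemma inverse_le_ln_diff: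
  fixes x :: real
  assumes "x > 1"
  shows "1 / x \<le> ln x - ln (x - 1)"
proof -
  have "ln ((x - 1) / x) \<le> (x - 1) / x - 1"
    using assms by (intro ln_le_minus_one) auto
  also have "\<dots> = - (1 / x)"
    using assms by (simp add: field_simps)
  finally show ?thesis
    using assms by (simp add: ln_div)
qed

lemma ln_ge_half:
  assumes "n \<ge> (2::nat)" shows "ln (real n) \<ge> 1 / 2"
proof -
  have "1 / 2 \<le> ln (2::real)" using inverse_le_ln_diff[of 2] by simp
  also have "\<dots> \<le> ln (real n)" using assms by simp
  finally show ?thesis .
qed

text \<open>Each term is compared with the integral of 1/x over [n - 1, n]. Capping the
  antiderivative \<open>ln (n - 1)\<close> at \<open>1 / l\<close> leaves its increments at the
  indices in \<open>A\<close> unchanged, because \<open>ln n \<le> 1 / l\<close> there, and bounds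
  it everywhere. Starting at 2, the lower end contributes \<open>ln 1 = 0\<close>.\<close>

lemma sum_reciprocal_le:
  assumes "finite A" "A \<subseteq> {2..}" "l > 0" "\<And>n. n \<in> A \<Longrightarrow> l * ln (real n) \<le> 1"
  shows "(\<Sum>n\<in>A. 1 / real n) \<le> 1 / l"
proof -
  have "(\<Sum>n\<in>A. 1 / real n) \<le> 1 / l - 0"
  proof (rule sum_le_of_increments[OF assms(1,2), where G = "\<lambda>n. min (ln (real n - 1)) (1 / l)"])
    fix n assume "n \<in> A"
    with assms have n: "2 \<le> n" "ln (real n) \<le> 1 / l" by (auto simp: field_simps)
    moreover have "ln (real n - 1) \<le> ln (real n)" using n by simp
    ultimately show "1 / real n \<le> min (ln (real (Suc n) - 1)) (1 / l) - min (ln (real n - 1)) (1 / l)"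
      using inverse_le_ln_diff[of n] by (simp add: min_def)
  next
    fix n :: nat assume "2 \<le> n"
    then have "ln (real n - 1) \<le> ln (real n)" by simp
    then show "min (ln (real n - 1)) (1 / l) \<le> min (ln (real (Suc n) - 1)) (1 / l)"
      by (auto simp: min_def)
  qed (use assms in auto)
  then show ?thesis by simp
qed

text \<open>A discrete form of the fact that -1/ln x is an antiderivative of 1/(x (ln x)^2). The
  factor 4 is 2 times 2: the logarithm grows by at least
  \<open>1 / (n + 1) \<ge> 1 / (2 * n)\<close>, and \<open>ln (n + 1) \<le> 2 * ln n\<close> because
  \<open>n + 1 \<le> n\<^sup>2\<close>.\<close>

lemma inverse_n_ln_squared_le:
  assumes "n \<ge> (2::nat)"
  shows "1 / (real n * (ln n)\<^sup>2) \<le> 4 * (1 / ln n - 1 / ln (Suc n))"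
proof -
  define x y where "x = ln (real n)" and "y = ln (real (Suc n))"
  have x: "x > 0" using assms by (simp add: x_def)
  have "1 / real (Suc n) \<le> y - x"
    using inverse_le_ln_diff[of "Suc n"] assms by (simp add: x_def y_def)
  moreover have "1 / (2 * real n) \<le> 1 / real (Suc n)"
    using assms by (simp add: field_simps)
  ultimately have d: "1 / (2 * real n) \<le> y - x" by linarith
  have "0 < 1 / (2 * real n)" using assms by simp
  with d have y: "y > x" by linarith
  have "real (Suc n) \<le> real (n ^ 2)"
    using assms by (intro of_nat_mono) (auto simp: power2_eq_square intro: order_trans[of _ "2 * n"])
  then have "y \<le> ln (real (n ^ 2))"
    unfolding y_def using assms by (subst ln_le_cancel_iff) auto
  then have y2: "y \<le> 2 * x" using assms by (simp add: x_def ln_realpow)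
  have "1 / (real n * x\<^sup>2) = 4 * ((1 / (2 * real n)) / (x * (2 * x)))"
    using x assms by (simp add: field_simps power2_eq_square)
  also have "\<dots> \<le> 4 * ((y - x) / (x * y))"
    using d x y y2 by (intro mult_left_mono frac_le) auto
  also have "\<dots> = 4 * (1 / x - 1 / y)"
    using x y by (simp add: field_simps)
  finally show ?thesis by (simp add: x_def y_def)
qed

text \<open>This sums the Schur weights over high frequencies. The cap at \<open>\<eta>\<close> is
  inactive at the indices in \<open>A\<close> and their successors, and it bounds the antiderivative
  from below by \<open>- 4 * \<eta>\<close>.\<close>

lemma sum_inverse_n_ln_squared_le:
  assumes "finite A" "A \<subseteq> {2..}" "\<eta> > 0" "\<And>n. n \<in> A \<Longrightarrow> 1 / ln (real n) \<le> \<eta>"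
  shows "(\<Sum>n\<in>A. 1 / (real n * (ln n)\<^sup>2)) \<le> 4 * \<eta>"
proof -
  have *: "1 / ln (real (Suc n)) \<le> 1 / ln (real n)" "0 \<le> 1 / ln (real n)" if "2 \<le> n" for n
    using that by (auto intro!: divide_left_mono mult_pos_pos)
  have "(\<Sum>n\<in>A. 1 / (real n * (ln n)\<^sup>2)) \<le> 0 - (- 4 * \<eta>)"
  proof (rule sum_le_of_increments[OF assms(1,2), where G = "\<lambda>n. - 4 * min (1 / ln (real n)) \<eta>"])
    fix n assume n: "n \<in> A"
    then have "2 \<le> n" "1 / ln (real n) \<le> \<eta>" using assms by auto
    then show "1 / (real n * (ln n)\<^sup>2) \<le> - 4 * min (1 / ln (real (Suc n))) \<eta> - - 4 * min (1 / ln (real n)) \<eta>"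
      using inverse_n_ln_squared_le[of n] *[of n] by (simp add: min_def)
  next
    fix n :: nat assume "2 \<le> n"
    then show "- 4 * min (1 / ln (real n)) \<eta> \<le> - 4 * min (1 / ln (real (Suc n))) \<eta>"
      using *[of n] by (auto simp: min_def)
  qed (use assms * in \<open>auto simp: min_def\<close>)
  then show ?thesis by simp
qed

text \<open>Completing the square, the derivative is
  \<open>(1 - \<eta>\<^sup>2) + \<eta>\<^sup>2 * (v + 1)\<^sup>2\<close> with
  \<open>v = ln u - L\<close>, and \<open>\<bar>\<eta>\<bar> \<le> 1\<close> makes both terms
  nonnegative. This restriction is why Schur's test runs with \<open>min l 1\<close> in place of
  \<open>l\<close>.\<close>

lemma mono_times_one_plus_ln_squared:
  fixes x y \<eta> L :: real
  assumes "0 < x" "x \<le> y" "\<bar>\<eta>\<bar> \<le> 1"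
  shows "x * (1 + \<eta>\<^sup>2 * (ln x - L)\<^sup>2) \<le> y * (1 + \<eta>\<^sup>2 * (ln y - L)\<^sup>2)"
proof (rule DERIV_nonneg_imp_nondecreasing[OF assms(2)])
  fix u assume u: "x \<le> u" "u \<le> y"
  define v where "v = ln u - L"
  have "((\<lambda>x. x * (1 + \<eta>\<^sup>2 * (ln x - L)\<^sup>2)) has_real_derivative 1 + \<eta>\<^sup>2 * v\<^sup>2 + 2 * \<eta>\<^sup>2 * v) (at u)"
    using u assms unfolding v_def
    by (auto intro!: derivative_eq_intros simp: field_simps)
  moreover have "1 + \<eta>\<^sup>2 * v\<^sup>2 + 2 * \<eta>\<^sup>2 * v = (1 - \<eta>\<^sup>2) + \<eta>\<^sup>2 * (v + 1)\<^sup>2"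
    by (simp add: algebra_simps power2_eq_square)
  moreover have "\<eta>\<^sup>2 \<le> 1" using assms(3) by (simp add: abs_square_le_1)
  ultimately show "\<exists>z. ((\<lambda>x. x * (1 + \<eta>\<^sup>2 * (ln x - L)\<^sup>2)) has_real_derivative z) (at u) \<and> 0 \<le> z"
    by auto
qed

text \<open>These are the row sums of Schur's test, uniform in \<open>L\<close>. In the variable ln
  x the summand is a Cauchy kernel, whose antiderivative is an arctangent of total variation
  \<open>pi / \<eta>\<close>. The mean value theorem gives the summand at some \<open>\<xi>\<close>
  between \<open>n - 1\<close> and \<open>n\<close>; the monotonicity of the denominator moves it to
  \<open>n\<close>.\<close>

lemma sum_reciprocal_kernel_le:
  fixes \<eta> L :: real
  assumes "finite A" "A \<subseteq> {2..}" "0 < \<eta>" "\<eta> \<le> 1"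
  shows "(\<Sum>m\<in>A. 1 / (real m * (1 + \<eta>\<^sup>2 * (ln m - L)\<^sup>2))) \<le> pi / \<eta>"
proof -
  define F where "F x = arctan (\<eta> * (ln x - L)) / \<eta>" for x
  have F: "\<exists>\<xi>. n - 1 < \<xi> \<and> \<xi> < n \<and> F n - F (n - 1) = 1 / (\<xi> * (1 + \<eta>\<^sup>2 * (ln \<xi> - L)\<^sup>2))" 
    if "1 < n" for n :: real
  proof -
    have "\<exists>\<xi>. n - 1 < \<xi> \<and> \<xi> < n \<and> F n - F (n - 1) = (n - (n - 1)) * (1 / (\<xi> * (1 + \<eta>\<^sup>2 * (ln \<xi> - L)\<^sup>2)))"
    proof (rule MVT2)
      fix x assume "n - 1 \<le> x" "x \<le> n"
      then have "x > 0" using that by simp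
      then show "(F has_real_derivative 1 / (x * (1 + \<eta>\<^sup>2 * (ln x - L)\<^sup>2))) (at x)"
        unfolding F_def using assms
        by (auto intro!: derivative_eq_intros simp: divide_simps power_mult_distrib)
    qed simp
    then show ?thesis by simp
  qed
  have "(\<Sum>m\<in>A. 1 / (real m * (1 + \<eta>\<^sup>2 * (ln m - L)\<^sup>2))) \<le> pi / 2 / \<eta> - (- (pi / 2) / \<eta>)"
  proof (rule sum_le_of_increments[OF assms(1,2), where G = "\<lambda>n. F (real n - 1)"])
    fix n assume "n \<in> A"
    then have n: "2 \<le> n" using assms by auto
    obtain \<xi> where \<xi>: "real n - 1 < \<xi>" "\<xi> < real n" "F n - F (real n - 1) = 1 / (\<xi> * (1 + \<eta>\<^sup>2 * (ln \<xi> - L)\<^sup>2))"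
      using F[of n] n by auto
    have "1 / (real n * (1 + \<eta>\<^sup>2 * (ln n - L)\<^sup>2)) \<le> 1 / (\<xi> * (1 + \<eta>\<^sup>2 * (ln \<xi> - L)\<^sup>2))"
      using \<xi> n assms mono_times_one_plus_ln_squared[of \<xi> n \<eta> L]
      by (intro divide_left_mono mult_pos_pos add_pos_nonneg) auto
    with \<xi> show "1 / (real n * (1 + \<eta>\<^sup>2 * (ln n - L)\<^sup>2)) \<le> F (real (Suc n) - 1) - F (real n - 1)"
      by simp
  next
    fix n :: nat assume n: "2 \<le> n"
    then have "ln (real n - 1) \<le> ln (real n)" by simp
    then show "F (real n - 1) \<le> F (real (Suc n) - 1)"
      unfolding F_def using assms by (auto intro!: divide_right_mono simp: arctan_le_iff)
  next
    fix n :: nat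
    show "F (real n - 1) \<le> pi / 2 / \<eta>"
      unfolding F_def using assms arctan_ubound less_imp_le by (intro divide_right_mono) auto
  next
    show "- (pi / 2) / \<eta> \<le> F (real 2 - 1)"
      unfolding F_def using assms arctan_lbound[of "\<eta> * (ln (real 2 - 1) - L)"]
      by (intro divide_right_mono) auto
  qed
  then show ?thesis by simp
qed

section \<open>Mean-square estimate of the high frequencies\<close>

text \<open>The parabolic window vanishes at both ends, which gives decay of order 1/x^2; the
  indicator of the interval would give only 1/x, for which the rows of Schur's test diverge. An
  upper bound is enough, since it will meet nonnegative coefficients. The constant 10 adds the
  trivial bound \<open>2 * l\<close> for the integral and the bound \<open>8 * l\<close> for
  \<open>l\<^sup>2 * x\<^sup>2\<close> times the integral.\<close>

lemma window_cos_integral: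
  fixes c l x :: real
  assumes l: "l > 0"
  shows "((\<lambda>t. (1 - ((t - c) / l)\<^sup>2) * cos (x * t)) has_integral
           integral {c - l..c + l} (\<lambda>t. (1 - ((t - c) / l)\<^sup>2) * cos (x * t))) {c - l..c + l}"
    and "integral {c - l..c + l} (\<lambda>t. (1 - ((t - c) / l)\<^sup>2) * cos (x * t)) \<le> 10 * l / (1 + l\<^sup>2 * x\<^sup>2)"
proof -
  define f where "f = (\<lambda>t. (1 - ((t - c) / l)\<^sup>2) * cos (x * t))"
  define J where "J = integral {c - l..c + l} f"
  have int: "f integrable_on {c - l..c + l}"
    unfolding f_def by (intro integrable_continuous_real continuous_intros) (use l in auto)
  then show "((\<lambda>t. (1 - ((t - c) / l)\<^sup>2) * cos (x * t)) has_integral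
           integral {c - l..c + l} (\<lambda>t. (1 - ((t - c) / l)\<^sup>2) * cos (x * t))) {c - l..c + l}"
    unfolding f_def by (rule integrable_integral)
  have 1: "J \<le> 2 * l"
  proof -
    have "J \<le> integral {c - l..c + l} (\<lambda>_. 1)"
      unfolding J_def
    proof (rule integral_le[OF int])
      fix t assume "t \<in> {c - l..c + l}"
      then have "\<bar>(t - c) / l\<bar> \<le> 1" using l by auto
      then have "((t - c) / l)\<^sup>2 \<le> 1" by (simp add: abs_square_le_1)
      then have "f t \<le> (1 - ((t - c) / l)\<^sup>2) * 1"
        unfolding f_def by (intro mult_left_mono) auto
      then show "f t \<le> 1" by (smt (verit) zero_le_power2)
    qed auto
    then show ?thesis using l by simp
  qed
  have 2: "J * (l\<^sup>2 * x\<^sup>2) \<le> 8 * l"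
  proof (cases "x = 0")
    case False
    \<comment> \<open>The antiderivative comes from repeated integration by parts. Its first term is
      0 at \<open>c - l\<close> and \<open>c + l\<close> together with the window, so no boundary
      term of order \<open>1 / x\<close> survives.\<close>
    define F where "F t = (1 - ((t - c) / l)\<^sup>2) * sin (x * t) / x
       - 2 * (t - c) / l\<^sup>2 * cos (x * t) / x\<^sup>2 + 2 / l\<^sup>2 * sin (x * t) / x ^ 3" for t
    have "(f has_integral F (c + l) - F (c - l)) {c - l..c + l}"
    proof (rule fundamental_theorem_of_calculus)
      fix t
      have "(F has_real_derivative f t) (at t)"
        unfolding F_def f_def using l False
        by (auto intro!: derivative_eq_intros simp: field_simps power2_eq_square power3_eq_cube)
      then show "(F has_vector_derivative f t) (at t within {c - l..c + l})"
        by (simp add: has_real_derivative_iff_has_vector_derivative has_vector_derivative_at_within)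
    qed (use l in auto)
    then have "J = F (c + l) - F (c - l)"
      unfolding J_def by (rule integral_unique)
    also have "\<dots> = - (2 / l) * (cos (x * (c + l)) + cos (x * (c - l))) / x\<^sup>2
                    + 2 / l\<^sup>2 * (sin (x * (c + l)) - sin (x * (c - l))) / x ^ 3"
      unfolding F_def using l False by (simp add: field_simps power2_eq_square power3_eq_cube)
    finally have J: "J = \<dots>" .
    have "J * (l\<^sup>2 * x\<^sup>2) = - 2 * l * (cos (x * (c + l)) + cos (x * (c - l)))
                    + 2 * ((sin (x * (c + l)) - sin (x * (c - l))) / x)"
      unfolding J using l False by (simp add: field_simps power2_eq_square power3_eq_cube)
    also have "\<dots> \<le> 2 * l * 2 + 2 * (2 * l)"
    proof (rule add_mono)
      have "- (cos (x * (c + l)) + cos (x * (c - l))) \<le> 2"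
        using cos_ge_minus_one[of "x * (c + l)"] cos_ge_minus_one[of "x * (c - l)"] by linarith
      from mult_left_mono[OF this, of "2 * l"] 
      show "- 2 * l * (cos (x * (c + l)) + cos (x * (c - l))) \<le> 2 * l * 2" using l by (simp add: algebra_simps)
      \<comment> \<open>The product form exposes \<open>sin (x * l)\<close>, and
        \<open>\<bar>sin (x * l)\<bar> \<le> \<bar>x * l\<bar>\<close> absorbs the division by
        \<open>x\<close>, however small \<open>x\<close> is.\<close>
      have "sin (x * (c + l)) - sin (x * (c - l)) = 2 * cos (x * c) * sin (x * l)"
        by (simp add: sin_diff_sin algebra_simps)
      moreover have "\<bar>2 * cos (x * c) * sin (x * l)\<bar> \<le> 2 * 1 * \<bar>x * l\<bar>"
        unfolding abs_mult by (intro mult_mono) (auto simp: abs_sin_x_le_abs_x simp flip: abs_mult)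
      ultimately have "\<bar>(sin (x * (c + l)) - sin (x * (c - l))) / x\<bar> \<le> 2 * l"
        using False l by (simp add: abs_mult field_simps)
      then have "(sin (x * (c + l)) - sin (x * (c - l))) / x \<le> 2 * l" by (rule abs_le_D1)
      then show "2 * ((sin (x * (c + l)) - sin (x * (c - l))) / x) \<le> 2 * (2 * l)"
        by (rule mult_left_mono) simp
    qed
    finally show ?thesis by simp
  qed (use l in auto)
  have "J * (1 + l\<^sup>2 * x\<^sup>2) \<le> 10 * l"
    using 1 2 by (simp add: algebra_simps)
  then have "J \<le> 10 * l / (1 + l\<^sup>2 * x\<^sup>2)"
    by (subst pos_le_divide_eq) (auto intro: add_pos_nonneg)
  then show "integral {c - l..c + l} (\<lambda>t. (1 - ((t - c) / l)\<^sup>2) * cos (x * t)) \<le> 10 * l / (1 + l\<^sup>2 * x\<^sup>2)"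
    unfolding J_def f_def .
qed

text \<open>Schur's test in symmetric form. The inequality of arithmetic and geometric means splits
  \<open>1 / (ln m * ln n)\<close> into squares, so each half is a weight \<open>p\<close> in one
  index times a reciprocal in the other, and the halves agree by symmetry of the kernel. The weights
  sum to at most \<open>8 * \<eta>\<close>, the rows to \<open>pi / \<eta>\<close>, and
  \<open>\<eta>\<close> cancels.\<close>

lemma double_sum_le:
  fixes b :: "nat \<Rightarrow> real"
  assumes A: "finite A" "A \<subseteq> {2..}" and l: "l > 0" and high: "\<And>n. n \<in> A \<Longrightarrow> 1 < l * ln n"
    and b: "\<And>n. n \<in> A \<Longrightarrow> 0 \<le> b n" "\<And>n. n \<in> A \<Longrightarrow> b n \<le> 1 / (n * ln n)"
  shows "(\<Sum>m\<in>A. \<Sum>n\<in>A. b m * b n / (1 + l\<^sup>2 * (ln m - ln n)\<^sup>2)) \<le> 8 * pi"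
proof -
  \<comment> \<open>The row sums require a scale of at most 1; lowering the scale only enlarges the
    kernel.\<close>
  define \<eta> where "\<eta> = min l 1"
  have \<eta>: "0 < \<eta>" "\<eta> \<le> 1" "\<eta> \<le> l" using l by (auto simp: \<eta>_def)
  define p where "p n = 1 / (real n * (ln n)\<^sup>2)" for n :: nat
  define k where "k m n = 1 / (1 + \<eta>\<^sup>2 * (ln (real n) - ln (real m))\<^sup>2)" for m n :: nat
  have k_sym: "k m n = k n m" for m n by (simp add: k_def power2_commute)
  have k0: "k m n \<ge> 0" for m n by (simp add: k_def)
  have term_le: "b m * b n / (1 + l\<^sup>2 * (ln m - ln n)\<^sup>2) \<le> (p m * (1 / n) + p n * (1 / m)) / 2 * k m n"
    if mn: "m \<in> A" "n \<in> A" for m n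
  proof -
    have pos: "real m > 0" "real n > 0" "ln (real m) > 0" "ln (real n) > 0"
      using mn A by fastforce+
    have "1 / ln m * (1 / ln n) \<le> ((1 / ln m)\<^sup>2 + (1 / ln n)\<^sup>2) / 2"
      using sum_squares_bound[of "1 / ln (real m)" "1 / ln (real n)"] by simp
    then have am_gm: "1 / (m * n) * (1 / ln m * (1 / ln n)) \<le> 1 / (m * n) * (((1 / ln m)\<^sup>2 + (1 / ln n)\<^sup>2) / 2)"
      by (rule mult_left_mono) simp
    have "b m * b n \<le> 1 / (m * ln m) * (1 / (n * ln n))"
      using mn b pos by (intro mult_mono) auto
    also have "\<dots> = 1 / (m * n) * (1 / ln m * (1 / ln n))" by simp
    also note am_gm
    also have "1 / (m * n) * (((1 / ln m)\<^sup>2 + (1 / ln n)\<^sup>2) / 2) = (p m * (1 / n) + p n * (1 / m)) / 2"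
      using pos by (simp add: p_def field_simps)
    finally have 1: "b m * b n \<le> (p m * (1 / n) + p n * (1 / m)) / 2" .
    have "\<eta>\<^sup>2 * (ln n - ln m)\<^sup>2 \<le> l\<^sup>2 * (ln m - ln n)\<^sup>2"
      unfolding power2_commute[of "ln (real n)"] using \<eta> by (intro mult_right_mono power_mono) auto
    then have 2: "1 / (1 + l\<^sup>2 * (ln m - ln n)\<^sup>2) \<le> k m n"
      unfolding k_def by (intro divide_left_mono mult_pos_pos add_pos_nonneg) auto
    have "0 \<le> b m * b n" using mn b by simp
    then have "b m * b n * (1 / (1 + l\<^sup>2 * (ln m - ln n)\<^sup>2)) \<le> (p m * (1 / n) + p n * (1 / m)) / 2 * k m n"
      using 1 2 by (intro mult_mono) auto
    then show ?thesis by simp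
  qed
  have swap: "(\<Sum>m\<in>A. \<Sum>n\<in>A. p n * (1 / m) * k m n) = (\<Sum>m\<in>A. \<Sum>n\<in>A. p m * (1 / n) * k m n)"
    by (subst sum.swap) (simp add: k_sym)
  have "(\<Sum>m\<in>A. \<Sum>n\<in>A. b m * b n / (1 + l\<^sup>2 * (ln m - ln n)\<^sup>2))
      \<le> (\<Sum>m\<in>A. \<Sum>n\<in>A. (p m * (1 / n) + p n * (1 / m)) / 2 * k m n)"
    by (intro sum_mono term_le)
  also have "\<dots> = ((\<Sum>m\<in>A. \<Sum>n\<in>A. p m * (1 / n) * k m n) + (\<Sum>m\<in>A. \<Sum>n\<in>A. p n * (1 / m) * k m n)) / 2"
    by (simp add: sum.distrib sum_divide_distrib add_divide_distrib distrib_right)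
  also have "\<dots> = (\<Sum>m\<in>A. \<Sum>n\<in>A. p m * (1 / n) * k m n)"
    unfolding swap by (rule field_sum_of_halves[unfolded add_divide_distrib[symmetric]])
  also have "\<dots> = (\<Sum>m\<in>A. p m * (\<Sum>n\<in>A. 1 / (n * (1 + \<eta>\<^sup>2 * (ln n - ln m)\<^sup>2))))"
    by (simp add: sum_distrib_left k_def mult.assoc)
  also have "\<dots> \<le> (\<Sum>m\<in>A. p m * (pi / \<eta>))"
    using A \<eta> by (intro sum_mono mult_left_mono sum_reciprocal_kernel_le) (auto simp: p_def)
  also have "\<dots> = (\<Sum>m\<in>A. p m) * (pi / \<eta>)"
    by (simp only: sum_distrib_right)
  also have "\<dots> \<le> 4 * (2 * \<eta>) * (pi / \<eta>)"
  proof (rule mult_right_mono)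
    \<comment> \<open>The value \<open>2 * \<eta>\<close> covers both cases of the minimum:
      \<open>1 / ln n \<le> 2\<close> if it is 1, and the high-frequency condition
      \<open>1 / ln n \<le> l\<close> if it is \<open>l\<close>.\<close>
    show "(\<Sum>m\<in>A. p m) \<le> 4 * (2 * \<eta>)"
      unfolding p_def
    proof (rule sum_inverse_n_ln_squared_le[OF A])
      fix n assume n: "n \<in> A"
      then have "1 / 2 \<le> ln (real n)" using ln_ge_half A by auto
      moreover have "1 < l * ln (real n)" using high n by simp
      ultimately have "1 / ln (real n) \<le> 2" "1 / ln (real n) \<le> l"
        by (auto simp: divide_simps)
      then show "1 / ln (real n) \<le> 2 * \<eta>" using l by (auto simp: \<eta>_def min_def)
    qed (use \<eta> in auto)
  qed (use \<eta> in auto)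
  also have "\<dots> = 8 * pi" using \<eta> by simp
  finally show ?thesis .
qed

lemma norm_trigonometric_sum_squared:
  fixes b x :: "nat \<Rightarrow> real"
  shows "(norm (\<Sum>n\<in>A. of_real (b n) * cis (- (x n * t))))\<^sup>2
       = (\<Sum>m\<in>A. \<Sum>n\<in>A. b m * b n * cos ((x m - x n) * t))"
proof -
  have "(norm (\<Sum>n\<in>A. of_real (b n) * cis (- (x n * t))))\<^sup>2
      = (\<Sum>n\<in>A. b n * cos (x n * t))\<^sup>2 + (\<Sum>n\<in>A. b n * sin (x n * t))\<^sup>2"
    by (simp add: cmod_power2 sum_negf)
  also have "\<dots> = (\<Sum>m\<in>A. \<Sum>n\<in>A. b m * b n * cos ((x m - x n) * t))"
    by (simp add: power2_eq_square sum_product cos_diff left_diff_distrib algebra_simps flip: sum.distrib)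
  finally show ?thesis .
qed

text \<open>An interval of length \<open>l\<close> sits in the middle half of a window of width
  \<open>2 * l\<close>, where the window is at least 3/4. The constant is the product of 4/3 from
  the window, 10 from the cosine integral and \<open>8 * pi\<close> from Schur's test.\<close>

lemma nn_integral_high_part_le:
  fixes b :: "nat \<Rightarrow> real"
  assumes A: "finite A" "A \<subseteq> {2..}" and l: "l > 0" and high: "\<And>n. n \<in> A \<Longrightarrow> 1 < l * ln n"
    and b: "\<And>n. n \<in> A \<Longrightarrow> 0 \<le> b n" "\<And>n. n \<in> A \<Longrightarrow> b n \<le> 1 / (n * ln n)"
  shows "(\<integral>\<^sup>+t\<in>{c - l / 2..c + l / 2}. ennreal ((norm (\<Sum>n\<in>A. of_real (b n) * cis (- (ln n * t))))\<^sup>2) \<partial>lborel)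
         \<le> ennreal (320 / 3 * pi * l)"
proof -
  define S where "S t = (norm (\<Sum>n\<in>A. of_real (b n) * cis (- (ln (real n) * t))))\<^sup>2" for t
  define W where "W t = 1 - ((t - c) / l)\<^sup>2" for t
  define J where "J x = integral {c - l..c + l} (\<lambda>t. W t * cos (x * t))" for x
  have S0: "S t \<ge> 0" for t by (simp add: S_def)
  have S: "S t = (\<Sum>m\<in>A. \<Sum>n\<in>A. b m * b n * cos ((ln m - ln n) * t))" for t
    unfolding S_def by (rule norm_trigonometric_sum_squared)
  have "((\<lambda>t. \<Sum>m\<in>A. \<Sum>n\<in>A. b m * b n * (W t * cos ((ln m - ln n) * t))) has_integral
        (\<Sum>m\<in>A. \<Sum>n\<in>A. b m * b n * J (ln m - ln n))) {c - l..c + l}"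
    using window_cos_integral(1)[OF l, of c] unfolding J_def W_def
    by (intro has_integral_sum has_integral_mult_right A)
  also have "(\<lambda>t. \<Sum>m\<in>A. \<Sum>n\<in>A. b m * b n * (W t * cos ((ln m - ln n) * t))) = (\<lambda>t. W t * S t)"
    by (simp add: S sum_distrib_left mult_ac)
  finally have int: "((\<lambda>t. W t * S t) has_integral
        (\<Sum>m\<in>A. \<Sum>n\<in>A. b m * b n * J (ln m - ln n))) {c - l..c + l}" .
  \<comment> \<open>Nonnegativity of the coefficients lets the one-sided bound on each cosine
    integral be used term by term.\<close>
  have "(\<Sum>m\<in>A. \<Sum>n\<in>A. b m * b n * J (ln m - ln n))
      \<le> (\<Sum>m\<in>A. \<Sum>n\<in>A. b m * b n * (10 * l / (1 + l\<^sup>2 * (ln m - ln n)\<^sup>2)))"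
    using b unfolding J_def W_def
    by (intro sum_mono mult_left_mono window_cos_integral(2)[OF l]) auto
  also have "\<dots> = 10 * l * (\<Sum>m\<in>A. \<Sum>n\<in>A. b m * b n / (1 + l\<^sup>2 * (ln m - ln n)\<^sup>2))"
    by (simp add: sum_distrib_left mult_ac)
  also have "\<dots> \<le> 10 * l * (8 * pi)"
    using l by (intro mult_left_mono double_sum_le A high b) auto
  finally have le: "(\<Sum>m\<in>A. \<Sum>n\<in>A. b m * b n * J (ln m - ln n)) \<le> 80 * pi * l" by (simp add: mult_ac)
  have "(\<integral>\<^sup>+t\<in>{c - l / 2..c + l / 2}. ennreal (S t) \<partial>lborel)
      \<le> (\<integral>\<^sup>+t\<in>{c - l..c + l}. ennreal (4 / 3 * (W t * S t)) \<partial>lborel)"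
  proof (rule nn_integral_mono)
    fix t
    show "ennreal (S t) * indicator {c - l / 2..c + l / 2} t
        \<le> ennreal (4 / 3 * (W t * S t)) * indicator {c - l..c + l} t"
    proof (cases "t \<in> {c - l / 2..c + l / 2}")
      case True
      then have "t - c \<le> l / 2" "- (t - c) \<le> l / 2" by auto
      then have "\<bar>t - c\<bar> \<le> l / 2" by (rule abs_leI)
      then have "\<bar>(t - c) / l\<bar> \<le> 1 / 2" using l by (simp add: field_simps)
      moreover have "\<bar>u\<bar> \<le> 1 / 2 \<Longrightarrow> 1 \<le> 4 / 3 * (1 - u\<^sup>2)" for u :: real
        using power_mono[of "\<bar>u\<bar>" "1 / 2" 2] by (simp add: power_one_over)
      ultimately have "1 \<le> 4 / 3 * W t" unfolding W_def by blast
      from mult_right_mono[OF this S0[of t]] have "S t \<le> 4 / 3 * (W t * S t)" by simp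
      with True l show ?thesis by (auto simp: indicator_def intro: ennreal_leI)
    qed auto
  qed
  also have "\<dots> = ennreal (4 / 3 * (\<Sum>m\<in>A. \<Sum>n\<in>A. b m * b n * J (ln m - ln n)))"
  proof (rule nn_integral_has_integral_lebesgue')
    fix t assume "t \<in> {c - l..c + l}"
    then have "\<bar>(t - c) / l\<bar> \<le> 1" using l by (auto simp: abs_le_iff field_simps)
    then have "W t \<ge> 0" by (simp add: W_def abs_square_le_1)
    then show "0 \<le> 4 / 3 * (W t * S t)" using S0 by simp
  qed (rule has_integral_mult_right[OF int])
  also have "\<dots> \<le> ennreal (320 / 3 * pi * l)"
    using le by (intro ennreal_leI) simp
  finally show ?thesis unfolding S_def .
qed

lemma norm_cis_diff_le: "norm (cis x - cis y) \<le> \<bar>x - y\<bar>"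
proof -
  have "cis x - cis y = cis y * (exp (\<i> * of_real (x - y)) - 1)"
    by (simp add: cis_conv_exp right_diff_distrib flip: exp_add)
  then have "norm (cis x - cis y) = 2 * \<bar>sin ((x - y) / 2)\<bar>"
    by (simp only: norm_mult dist_exp_i_1 norm_cis mult_1)
  also have "\<dots> \<le> 2 * \<bar>(x - y) / 2\<bar>"
    by (intro mult_left_mono abs_sin_x_le_abs_x) simp
  finally show ?thesis by simp
qed

text \<open>The variation of each exponential brings down its frequency \<open>ln n\<close>, which
  cancels the logarithm in the coefficient and leaves the sum of \<open>1 / n\<close> over the low
  frequencies.\<close>

lemma low_part_oscillation:
  fixes b :: "nat \<Rightarrow> real"
  assumes A: "finite A" "A \<subseteq> {2..}" and l: "l > 0" and low: "\<And>n. n \<in> A \<Longrightarrow> l * ln n \<le> 1"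
    and b: "\<And>n. n \<in> A \<Longrightarrow> 0 \<le> b n" "\<And>n. n \<in> A \<Longrightarrow> b n \<le> 1 / (n * ln n)"
  shows "norm ((\<Sum>n\<in>A. of_real (b n) * cis (- (ln n * t))) - (\<Sum>n\<in>A. of_real (b n) * cis (- (ln n * c)))) \<le> \<bar>t - c\<bar> / l"
proof -
  have "norm ((\<Sum>n\<in>A. of_real (b n) * cis (- (ln n * t))) - (\<Sum>n\<in>A. of_real (b n) * cis (- (ln n * c))))
     = norm (\<Sum>n\<in>A. of_real (b n) * (cis (- (ln n * t)) - cis (- (ln n * c))))"
    by (simp add: sum_subtractf right_diff_distrib)
  also have "\<dots> \<le> (\<Sum>n\<in>A. (1 / n) * \<bar>t - c\<bar>)"
  proof (rule sum_norm_le)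
    fix n assume n: "n \<in> A"
    then have n2: "2 \<le> n" using A by auto
    have "norm (of_real (b n) * (cis (- (ln n * t)) - cis (- (ln n * c)))) \<le> b n * \<bar>- (ln n * t) - - (ln n * c)\<bar>"
      unfolding norm_mult using b(1)[OF n] by (intro mult_mono norm_cis_diff_le) auto
    also have "\<bar>- (ln n * t) - - (ln n * c)\<bar> = ln n * \<bar>t - c\<bar>"
      using n2 by (simp add: abs_mult abs_minus_commute flip: right_diff_distrib)
    also have "b n * (ln n * \<bar>t - c\<bar>) \<le> 1 / (n * ln n) * (ln n * \<bar>t - c\<bar>)"
      using b(2)[OF n] n2 by (intro mult_right_mono) auto
    also have "\<dots> = (1 / n) * \<bar>t - c\<bar>"
      using n2 by simp
    finally show "norm (of_real (b n) * (cis (- (ln n * t)) - cis (- (ln n * c)))) \<le> (1 / n) * \<bar>t - c\<bar>" .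
  qed
  also have "\<dots> = (\<Sum>n\<in>A. 1 / n) * \<bar>t - c\<bar>" by (simp add: sum_distrib_right)
  also have "\<dots> \<le> 1 / l * \<bar>t - c\<bar>"
    using sum_reciprocal_le[OF A l low] by (intro mult_right_mono) auto
  finally show ?thesis by simp
qed

subsection \<open>The Dirichlet series and its singularity at 0\<close>

definition log_term :: "nat \<Rightarrow> complex \<Rightarrow> complex" where
  "log_term n s = 1 / (of_nat n * of_real (ln (real n))) * of_nat n powr (- s)"

definition log_series :: "complex \<Rightarrow> complex" where
  "log_series s = (\<Sum>k. log_term (k + 2) s)"

text \<open>With modulus and oscillation separated, the series on the line
  \<open>Re s = \<epsilon>\<close> is a trigonometric sum with frequencies \<open>ln n\<close>. The
  boundary line \<open>\<epsilon> = 0\<close> is included.\<close>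

lemma log_term_Complex:
  assumes "n \<ge> 2"
  shows "log_term n (Complex \<epsilon> t) = of_real (real n powr (-1 - \<epsilon>) / ln n) * cis (- (ln n * t))"
proof -
  have "of_nat n powr (- Complex \<epsilon> t) = exp (of_real (- \<epsilon> * ln n)) * cis (- (ln n * t))"
    using assms by (simp add: powr_def Ln_of_nat cis_conv_exp Complex_eq algebra_simps flip: exp_add)
  moreover have "real n powr (-1 - \<epsilon>) = real n powr (- \<epsilon>) / real n powr 1"
    by (subst powr_diff[symmetric], subst minus_diff_commute, rule refl)
  then have "real n powr (-1 - \<epsilon>) = exp (- \<epsilon> * ln n) / n"
    using assms by (simp add: powr_def)
  ultimately show ?thesis
    using assms by (simp add: log_term_def flip: exp_of_real)
qed

lemma norm_of_nat_powr: "n \<noteq> 0 \<Longrightarrow> norm (of_nat n powr z :: complex) = real n powr Re z"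
  by (subst norm_powr_real_powr) auto

lemma norm_log_term_le:
  assumes "n \<ge> 2" "\<delta> \<le> Re s"
  shows "norm (log_term n s) \<le> 2 * real n powr (-1 - \<delta>)"
proof -
  have half: "1 / 2 \<le> ln (real n)" using assms by (intro ln_ge_half)
  have "norm (log_term n s) = real n powr (-1 - Re s) / ln n"
    using assms by (subst complex_surj[symmetric, of s], subst log_term_Complex) (simp_all add: norm_mult norm_divide)
  also have "\<dots> \<le> real n powr (-1 - \<delta>) / (1 / 2)"
    using assms half by (intro frac_le powr_mono) auto
  finally show ?thesis by simp
qed

lemma summable_real_powr_shift: "a < -1 \<Longrightarrow> summable (\<lambda>k. real (k + m) powr a)"
  using summable_ignore_initial_segment[of "\<lambda>k. real k powr a" m] by (simp add: summable_real_powr_iff)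

text \<open>Differentiation cancels the logarithms. The existential form ties the derivative to the
  sum of the differentiated series, which is what the comparison with \<open>1 / s\<close> works
  on.\<close>

lemma log_series_derivative:
  assumes "Re s > 0"
  shows "(\<lambda>k. log_term (k + 2) s) sums log_series s"
    and "\<exists>D. (\<lambda>k. - (of_nat (k + 2) powr (-1 - s))) sums D \<and> (log_series has_field_derivative D) (at s)"
proof -
  have op: "open {s. 0 < Re s}" by (rule open_halfspace_Re_gt)
  have "\<exists>g g'. \<forall>x\<in>{s. 0 < Re s}. (\<lambda>k. log_term (k + 2) x) sums g x \<and>
     (\<lambda>k. - (of_nat (k + 2) powr (-1 - x))) sums g' x \<and> (g has_field_derivative g' x) (at x)"
  proof (rule series_and_derivative_comparison_complex[OF op])
    fix n :: nat and x :: complex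
    have nz: "(of_nat (n + 2) :: complex) \<noteq> 0" by (metis of_nat_eq_0_iff add_is_0 zero_neq_numeral)
    have "(log_term (n + 2) has_field_derivative
        1 / (of_nat (n + 2) * of_real (ln (real (n + 2)))) * (Ln (of_nat (n + 2)) * of_nat (n + 2) powr (- x) * - 1)) (at x)"
      unfolding log_term_def
      by (rule DERIV_cmult, rule DERIV_chain2[where g = uminus, OF has_field_derivative_powr_right[OF nz]])
        (auto intro!: derivative_eq_intros)
    moreover have "Ln (of_nat (n + 2)) = of_real (ln (real (n + 2)))"
      by (rule Ln_of_nat) simp
    moreover have "ln (real (n + 2)) \<noteq> 0" by simp
    moreover have "(of_nat (n + 2) :: complex) powr (-1 - x) = of_nat (n + 2) powr (- x) / of_nat (n + 2)"
      by (subst minus_diff_commute, subst powr_diff) (simp del: of_nat_add of_nat_Suc)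
    ultimately show "(log_term (n + 2) has_field_derivative - (of_nat (n + 2) powr (-1 - x))) (at x)"
      by (simp del: of_nat_add of_nat_Suc)
  next
    fix x assume x: "x \<in> {s. 0 < Re s}"
    \<comment> \<open>A majorant on the ball of radius \<open>Re x / 2\<close> around
      \<open>x\<close>, where \<open>Re y \<ge> Re x / 2\<close>; it is complex-valued as the
      comparison theorem requires.\<close>
    define h where "h k = complex_of_real (2 * real (k + 2) powr (-1 - Re x / 2))" for k
    have "norm (log_term (n + 2) y) \<le> norm (h n)" if "y \<in> ball x (Re x / 2)" for n y
    proof -
      have "\<bar>Re x - Re y\<bar> < Re x / 2"
        using that abs_Re_le_cmod[of "x - y"] by (simp add: dist_norm)
      then have "Re x / 2 \<le> Re y" by linarith
      then show ?thesis
        unfolding h_def using norm_log_term_le[of "n + 2" "Re x / 2" y] by (simp add: norm_mult del: of_nat_add)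
    qed
    moreover have "summable h"
      unfolding h_def using x
      by (intro summable_of_real summable_mult summable_real_powr_shift) auto
    moreover have "range h \<subseteq> \<real>\<^sub>\<ge>\<^sub>0" by (auto simp: h_def)
    ultimately show "\<exists>d h::nat \<Rightarrow> complex. 0 < d \<and> summable h \<and> range h \<subseteq> \<real>\<^sub>\<ge>\<^sub>0 \<and>
        (\<forall>\<^sub>F n in sequentially. \<forall>y\<in>ball x d \<inter> {s. 0 < Re s}. norm (log_term (n + 2) y) \<le> norm (h n))"
      using x by (intro exI[of _ "Re x / 2"] exI[of _ h]) auto
  qed
  then obtain g g' where g: "\<And>x. 0 < Re x \<Longrightarrow> (\<lambda>k. log_term (k + 2) x) sums g x"
     "\<And>x. 0 < Re x \<Longrightarrow> (\<lambda>k. - (of_nat (k + 2) powr (-1 - x))) sums g' x"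
     "\<And>x. 0 < Re x \<Longrightarrow> (g has_field_derivative g' x) (at x)"
    by blast
  have eq: "log_series x = g x" if "0 < Re x" for x
    unfolding log_series_def using g(1)[OF that] by (simp add: sums_iff)
  then show "(\<lambda>k. log_term (k + 2) s) sums log_series s" using g(1) assms by simp
  have "(log_series has_field_derivative g' s) (at s)"
    by (rule has_field_derivative_transform_within_open[OF g(3)[OF assms] op]) (use assms eq in auto)
  with g(2)[OF assms]
  show "\<exists>D. (\<lambda>k. - (of_nat (k + 2) powr (-1 - s))) sums D \<and> (log_series has_field_derivative D) (at s)"
    by blast
qed

text \<open>The first quotient is the integral of u^(-1 - s) over [n, n + 1]. Replacing it by the
  value at the left end costs at most \<open>2 / n\<close>, and also at most
  \<open>norm (1 + s) / n\<^sup>2\<close> by the derivative of the integrand. The geometric mean of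
  the two is summable in \<open>n\<close> and grows only like the square root of
  \<open>norm (1 + s)\<close>.\<close>

lemma powr_difference_bound:
  fixes s :: complex and n :: nat
  assumes s: "Re s > 0" and n: "n \<ge> 1"
  shows "norm ((of_nat n powr (- s) - of_nat (Suc n) powr (- s)) / s - of_nat n powr (-1 - s))
       \<le> sqrt 2 * sqrt (norm (1 + s)) * real n powr (- 3 / 2)"
proof -
  \<comment> \<open>The segment from \<open>n\<close> to \<open>n + 1\<close>, seen as a convex
    subset of the complex plane so that the complex mean value inequality applies;
    \<open>\<phi>\<close> is an antiderivative of \<open>z powr (-1 - s)\<close> on it.\<close>
  define S where "S = \<real> \<inter> ({z. real n \<le> Re z} \<inter> {z. Re z \<le> real (Suc n)})"
  define \<phi> where "\<phi> z = - (z powr (- s)) / s" for z :: complex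
  define d where "d = \<phi> (of_nat (Suc n)) - \<phi> (of_nat n) - of_nat n powr (-1 - s)"
  have S: "convex S" "of_nat n \<in> S" "of_nat (Suc n) \<in> S"
    unfolding S_def
    by (auto intro!: convex_Int convex_halfspace_Re_ge convex_halfspace_Re_le convex_Reals simp del: of_nat_Suc)
  have pos: "z \<notin> \<real>\<^sub>\<le>\<^sub>0" "z \<noteq> 0" "z \<in> \<real>" "0 < Re z" "real n \<le> Re z" if "z \<in> S" for z
    using that n by (auto simp: S_def complex_nonpos_Reals_iff complex_is_Real_iff)
  have s0: "s \<noteq> 0" using s by auto
  have powr_le: "norm (z powr w) \<le> real n powr Re w" if "z \<in> S" "Re w \<le> 0" for z w
    using pos[OF that(1)] that n by (simp add: norm_powr_real_powr powr_mono2')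
  have \<phi>: "(\<phi> has_field_derivative z powr (-1 - s)) (at z within S)" if "z \<in> S" for z
  proof -
    have "((\<lambda>z. z powr (- s)) has_field_derivative - s * z powr (- s - 1)) (at z within S)"
      using pos[OF that] by (intro has_field_derivative_at_within[OF has_field_derivative_powr])
    from DERIV_cmult[OF this, of "- 1 / s"]
    have "((\<lambda>z. - (z powr (- s)) / s) has_field_derivative z powr (- s - 1)) (at z within S)"
      using s0 by simp
    moreover have "- s - 1 = -1 - s" by (rule minus_diff_commute)
    ultimately show ?thesis unfolding \<phi>_def by metis
  qed
  have le: "real n powr x \<le> real n powr y" if "x \<le> y" for x y
    using n that by (intro powr_mono) auto
  have "norm (\<phi> (of_nat (Suc n)) - \<phi> (of_nat n)) \<le> real n powr (-1) * norm (of_nat (Suc n) - of_nat n :: complex)"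
  proof (rule field_differentiable_bound[OF S(1) \<phi>])
    fix z assume "z \<in> S"
    then have "norm (z powr (-1 - s)) \<le> real n powr Re (-1 - s)" by (rule powr_le) (use s in simp)
    also have "\<dots> \<le> real n powr (-1)" using s by (intro le) simp
    finally show "norm (z powr (-1 - s)) \<le> real n powr (-1)" .
  qed (use S in auto)
  moreover have "norm (of_nat n powr (-1 - s)) \<le> real n powr (-1)"
    using powr_le[OF S(2), of "-1 - s"] le[of "Re (-1 - s)" "-1"] s by simp
  ultimately have 1: "norm d \<le> 2 * real n powr (-1)"
    unfolding d_def by (intro order_trans[OF norm_triangle_ineq4]) simp
  have D: "norm (z powr (-1 - s) - of_nat n powr (-1 - s)) \<le> norm (1 + s) * real n powr (-2)" if z: "z \<in> S" for z
  proof -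
    have "norm (z powr (-1 - s) - of_nat n powr (-1 - s)) \<le> norm (1 + s) * real n powr (-2) * norm (z - of_nat n)"
    proof (rule field_differentiable_bound[OF S(1)])
      fix z assume z: "z \<in> S"
      show "((\<lambda>z. z powr (-1 - s)) has_field_derivative (-1 - s) * z powr (-1 - s - 1)) (at z within S)"
        using pos[OF z] by (intro has_field_derivative_at_within[OF has_field_derivative_powr])
      have "norm (z powr (-1 - s - 1)) \<le> real n powr Re (-1 - s - 1)" using z by (rule powr_le) (use s in simp)
      also have "\<dots> \<le> real n powr (-2)" using s by (intro le) simp
      finally have "norm (z powr (-1 - s - 1)) \<le> real n powr (-2)" .
      moreover have "norm (-1 - s) = norm (1 + s)" by (metis minus_diff_eq norm_minus_cancel diff_minus_eq_add add.commute)
      ultimately show "norm ((-1 - s) * z powr (-1 - s - 1)) \<le> norm (1 + s) * real n powr (-2)"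
        unfolding norm_mult by (simp add: mult_left_mono)
    qed (use z S in auto)
    also have "\<dots> \<le> norm (1 + s) * real n powr (-2) * 1"
    proof (rule mult_left_mono)
      have "norm (z - of_nat n) = \<bar>Re z - real n\<bar>"
        using z by (auto simp: S_def cmod_def complex_is_Real_iff)
      then show "norm (z - of_nat n) \<le> 1" using z by (simp add: S_def)
    qed simp
    finally show ?thesis by simp
  qed
  \<comment> \<open>Subtracting the linear function of slope \<open>n powr (-1 - s)\<close> turns
    the error \<open>d\<close> into an increment of \<open>\<psi>\<close>, whose derivative is
    controlled by \<open>D\<close>.\<close>
  define \<psi> where "\<psi> z = \<phi> z - z * of_nat n powr (-1 - s)" for z
  have "norm (\<psi> (of_nat (Suc n)) - \<psi> (of_nat n)) \<le> norm (1 + s) * real n powr (-2) * norm (of_nat (Suc n) - of_nat n :: complex)"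
  proof (rule field_differentiable_bound[OF S(1) _ D])
    fix z assume "z \<in> S"
    from \<phi>[OF this]
    show "(\<psi> has_field_derivative z powr (-1 - s) - of_nat n powr (-1 - s)) (at z within S)"
      unfolding \<psi>_def by (auto intro!: derivative_eq_intros)
  qed (use S in auto)
  moreover have "\<psi> (of_nat (Suc n)) - \<psi> (of_nat n) = d"
    by (simp add: \<psi>_def d_def algebra_simps)
  ultimately have 2: "norm d \<le> norm (1 + s) * real n powr (-2)" by simp
  \<comment> \<open>One factor under the root takes the bound uniform in \<open>s\<close>, the other
    the bound linear in \<open>s\<close>.\<close>
  have "norm d = sqrt (norm d * norm d)" by simp
  also have "\<dots> \<le> sqrt ((2 * real n powr (-1)) * (norm (1 + s) * real n powr (-2)))"
    using 1 2 by (intro real_sqrt_le_mono mult_mono) auto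
  also have "(2 * real n powr (-1)) * (norm (1 + s) * real n powr (-2)) = 2 * norm (1 + s) * real n powr (-3)"
  proof -
    have "real n powr (-3) = real n powr (-1) * real n powr (-2)"
      by (subst powr_add[symmetric]) simp
    then show ?thesis by (simp only: mult_ac)
  qed
  also have "sqrt \<dots> = sqrt 2 * sqrt (norm (1 + s)) * real n powr (- 3 / 2)"
    by (simp add: real_sqrt_mult flip: powr_half_sqrt_powr)
  finally show ?thesis
    by (simp add: d_def \<phi>_def diff_divide_distrib algebra_simps)
qed

text \<open>Summed over all \<open>n \<ge> 1\<close>, the integrals telescope to
  \<open>1 / s\<close>. The series for \<open>D\<close> begins at 2, so the term
  \<open>q 1 = 1\<close> has to be added; it accounts for the summand 1 in \<open>C\<close>, and the
  rest of \<open>C\<close> is sqrt 2 times zeta(3/2).\<close>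

lemma log_series_derivative_bound:
  obtains C where "C > 0" "\<And>s. Re s > 0 \<Longrightarrow>
    \<exists>D. (log_series has_field_derivative D) (at s) \<and> norm (D + 1 / s) \<le> C * sqrt (1 + norm s)"
proof -
  define Z where "Z = (\<Sum>k. real (k + 1) powr (- 3 / 2))"
  have sZ: "summable (\<lambda>k. real (k + 1) powr (- 3 / 2))" by (rule summable_real_powr_shift) simp
  have Z0: "Z \<ge> 0" unfolding Z_def by (intro suminf_nonneg sZ) simp
  define C where "C = 1 + sqrt 2 * Z"
  have bound: "norm (D + 1 / s) \<le> C * sqrt (1 + norm s)"
    if s: "Re s > 0" and D: "(\<lambda>k. - (of_nat (k + 2) powr (-1 - s))) sums D" for s D
  proof -
    define q where "q n = (of_nat n powr (-1 - s) :: complex)" for n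
    define e where "e k = (of_nat (k + 1) powr (- s) - of_nat (Suc (k + 1)) powr (- s)) / s - q (k + 1)" for k
    have "(\<lambda>k. of_nat (k + 1) powr (- s) / s) \<longlonglongrightarrow> 0"
    proof (rule Lim_null_comparison)
      have "(\<lambda>k. real k powr (- Re s)) \<longlonglongrightarrow> 0"
        using s by (intro tendsto_neg_powr filterlim_real_sequentially) auto
      then have "(\<lambda>k. real (k + 1) powr (- Re s)) \<longlonglongrightarrow> 0" by (rule LIMSEQ_ignore_initial_segment)
      from tendsto_mult_left_zero[OF this, of "1 / norm s"]
      show "(\<lambda>k. real (k + 1) powr (- Re s) / norm s) \<longlonglongrightarrow> 0" by simp
      show "\<forall>\<^sub>F k in sequentially. norm (of_nat (k + 1) powr (- s) / s) \<le> real (k + 1) powr (- Re s) / norm s"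
        by (simp add: norm_divide norm_of_nat_powr del: of_nat_add of_nat_Suc)
    qed
    from telescope_sums'[OF this]
    have T: "(\<lambda>k. of_nat (k + 1) powr (- s) / s - of_nat (Suc k + 1) powr (- s) / s) sums (of_nat (0 + 1) powr (- s) / s - 0)" .
    have Q: "(\<lambda>k. q (k + 1)) sums (- D + q 1)"
    proof -
      have "(\<lambda>k. q (Suc k + 1)) sums (- D)" using sums_minus[OF D] by (simp add: q_def)
      from sums_Suc[of "\<lambda>k. q (k + 1)", OF this] show ?thesis by simp
    qed
    have "e = (\<lambda>k. of_nat (k + 1) powr (- s) / s - of_nat (Suc k + 1) powr (- s) / s - q (k + 1))"
      by (simp add: e_def diff_divide_distrib fun_eq_iff)
    moreover have "of_nat (0 + 1) powr (- s) / s - 0 - (- D + q 1) = 1 / s - (- D + 1)"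
      by (simp add: q_def)
    ultimately have "e sums (1 / s - (- D + 1))"
      using sums_diff[OF T Q] by (simp only:)
    then have e_eq: "1 / s - (- D + 1) = suminf e" by (rule sums_unique)
    have e: "norm (e k) \<le> sqrt 2 * sqrt (norm (1 + s)) * real (k + 1) powr (- 3 / 2)" for k
      unfolding e_def q_def by (rule powr_difference_bound[OF s]) simp
    have "norm (1 / s - (- D + 1)) \<le> sqrt 2 * sqrt (norm (1 + s)) * Z"
      unfolding Z_def suminf_mult[OF sZ, symmetric] e_eq
      by (rule norm_suminf_le[OF e summable_mult[OF sZ]])
    moreover have "D + 1 / s = (1 / s - (- D + 1)) + 1" by simp
    ultimately have "norm (D + 1 / s) \<le> sqrt 2 * sqrt (norm (1 + s)) * Z + 1"
      by (metis add_right_mono norm_one norm_triangle_ineq order_trans)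
    also have "\<dots> \<le> sqrt 2 * sqrt (1 + norm s) * Z + sqrt (1 + norm s)"
      using Z0 norm_triangle_ineq[of 1 s] by (intro add_mono mult_right_mono mult_left_mono real_sqrt_le_mono) auto
    also have "\<dots> = C * sqrt (1 + norm s)" by (simp add: C_def algebra_simps)
    finally show ?thesis .
  qed
  have "C > 0" using Z0 by (simp add: C_def add_pos_nonneg)
  moreover have "\<exists>D. (log_series has_field_derivative D) (at s) \<and> norm (D + 1 / s) \<le> C * sqrt (1 + norm s)"
    if "Re s > 0" for s
    using log_series_derivative(2)[OF that] bound[OF that] by blast
  ultimately show ?thesis using that by blast
qed

text \<open>The mean value inequality on a convex half-disc. The dependence on \<open>R\<close> is
  explicit because the estimate serves twice: with bounded \<open>R\<close> for limits at the
  boundary, with growing \<open>R\<close> for the growth of the series.\<close>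

lemma log_series_plus_Ln_lipschitz:
  obtains C where "C > 0" "\<And>R z w. 0 < Re z \<Longrightarrow> 0 < Re w \<Longrightarrow> norm z \<le> R \<Longrightarrow> norm w \<le> R \<Longrightarrow>
    norm ((log_series z + Ln z) - (log_series w + Ln w)) \<le> C * sqrt (1 + R) * norm (z - w)"
proof -
  obtain C where C: "C > 0" and *: "\<And>s. Re s > 0 \<Longrightarrow>
    \<exists>D. (log_series has_field_derivative D) (at s) \<and> norm (D + 1 / s) \<le> C * sqrt (1 + norm s)"
    by (rule log_series_derivative_bound) blast
  then obtain D where D: "\<And>s. Re s > 0 \<Longrightarrow> (log_series has_field_derivative D s) (at s)"
    "\<And>s. Re s > 0 \<Longrightarrow> norm (D s + 1 / s) \<le> C * sqrt (1 + norm s)"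
    by metis
  have "norm ((log_series z + Ln z) - (log_series w + Ln w)) \<le> C * sqrt (1 + R) * norm (z - w)"
    if zw: "0 < Re z" "0 < Re w" "norm z \<le> R" "norm w \<le> R" for R z w
  proof (rule field_differentiable_bound[where S = "{s. 0 < Re s} \<inter> cball 0 R" and f' = "\<lambda>s. D s + 1 / s"])
    show "convex ({s. 0 < Re s} \<inter> cball 0 R)"
      by (intro convex_Int convex_halfspace_Re_gt convex_cball)
  next
    fix s assume s: "s \<in> {s. 0 < Re s} \<inter> cball 0 R"
    then have "s \<notin> \<real>\<^sub>\<le>\<^sub>0" by (auto simp: complex_nonpos_Reals_iff)
    then show "((\<lambda>s. log_series s + Ln s) has_field_derivative D s + 1 / s) (at s within {s. 0 < Re s} \<inter> cball 0 R)"
      using s by (intro has_field_derivative_at_within[OF DERIV_add[OF D(1)]])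
        (auto intro!: derivative_eq_intros simp: divide_simps)
    have "norm (D s + 1 / s) \<le> C * sqrt (1 + norm s)" using s by (intro D(2)) simp
    also have "\<dots> \<le> C * sqrt (1 + R)"
      using s C by (intro mult_left_mono real_sqrt_le_mono) auto
    finally show "norm (D s + 1 / s) \<le> C * sqrt (1 + R)" .
  qed (use zw in auto)
  with C that show ?thesis by blast
qed

lemma closure_right_half_plane: "closure {s. 0 < Re s} = {s. 0 \<le> Re s}"
  using closure_halfspace_gt[of "1::complex" 0] by (simp add: complex_inner_1)

text \<open>The Lipschitz function \<open>h\<close> extends continuously to the closure of a
  half-disc around the point, and \<open>Ln\<close> is continuous there as the point is not 0. The
  limit is over the whole half-plane, which is stronger than a nontangential one.\<close>

lemma log_series_limit:
  assumes "t \<noteq> 0"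
  shows "\<exists>l. (log_series \<longlongrightarrow> l) (at (Complex 0 t) within right_half_plane)"
proof -
  define p where "p = Complex 0 t"
  define X where "X = {s. 0 < Re s} \<inter> ball 0 (\<bar>t\<bar> + 1)"
  define h where "h s = log_series s + Ln s" for s
  obtain C where C: "C > 0" and lip: "\<And>R z w. 0 < Re z \<Longrightarrow> 0 < Re w \<Longrightarrow> norm z \<le> R \<Longrightarrow> norm w \<le> R \<Longrightarrow>
    norm ((log_series z + Ln z) - (log_series w + Ln w)) \<le> C * sqrt (1 + R) * norm (z - w)"
    by (rule log_series_plus_Ln_lipschitz) blast
  have "(C * sqrt (1 + (\<bar>t\<bar> + 1)))-lipschitz_on X h"
    using C lip[where R = "\<bar>t\<bar> + 1"] by (intro lipschitz_onI) (auto simp: X_def h_def dist_norm)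
  then have "uniformly_continuous_on X h" by (rule lipschitz_on_uniformly_continuous)
  moreover have "p \<in> closure X"
  proof -
    have "p \<in> ball 0 (\<bar>t\<bar> + 1) \<inter> closure {s. 0 < Re s}"
      by (simp add: p_def closure_right_half_plane cmod_def)
    also have "\<dots> \<subseteq> closure (ball 0 (\<bar>t\<bar> + 1) \<inter> {s. 0 < Re s})"
      by (rule open_Int_closure_subset) simp
    finally show ?thesis by (simp add: X_def Int_commute)
  qed
  ultimately obtain l where "(h \<longlongrightarrow> l) (at p within X)"
    by (rule uniformly_continuous_on_extension_at_closure)
  also have "at p within X = at p within right_half_plane"
    unfolding X_def right_half_plane_def
    by (intro at_within_nhd[of _ "ball 0 (\<bar>t\<bar> + 1)"]) (auto simp: p_def cmod_def)
  finally have "(h \<longlongrightarrow> l) (at p within right_half_plane)" .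
  moreover have "(Ln \<longlongrightarrow> Ln p) (at p within right_half_plane)"
    using assms by (intro tendsto_Ln tendsto_ident_at) (auto simp: p_def complex_nonpos_Reals_iff)
  ultimately have "((\<lambda>s. h s - Ln s) \<longlongrightarrow> l - Ln p) (at p within right_half_plane)"
    by (rule tendsto_diff)
  then show ?thesis by (auto simp: h_def p_def)
qed

lemma norm_log_series_le:
  assumes "\<delta> > 0" "\<delta> \<le> Re s"
  shows "norm (log_series s) \<le> (\<Sum>k. 2 * real (k + 2) powr (-1 - \<delta>))"
proof -
  have "Re s > 0" using assms by simp
  have sm: "summable (\<lambda>k. 2 * real (k + 2) powr (-1 - \<delta>))"
    using assms by (intro summable_mult summable_real_powr_shift) auto
  have "norm (\<Sum>k. log_term (k + 2) s) \<le> (\<Sum>k. 2 * real (k + 2) powr (-1 - \<delta>))"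
    using assms by (intro norm_suminf_le[OF _ sm] norm_log_term_le) auto
  then show ?thesis by (simp add: log_series_def)
qed

lemma ln_le_two_sqrt: "x > 0 \<Longrightarrow> ln x \<le> 2 * sqrt x"
  using ln_bound[of "sqrt x"] by (simp add: ln_sqrt)

lemma norm_Ln_le: "z \<noteq> 0 \<Longrightarrow> norm (Ln z) \<le> \<bar>ln (norm z)\<bar> + pi"
  using cmod_le[of "Ln z"] mpi_less_Im_Ln[of z] Im_Ln_le_pi[of z] by (simp add: Re_Ln abs_le_iff)

text \<open>The point \<open>s\<close> is compared with \<open>s + 1\<close>, where the series
  converges absolutely with a uniform bound; the Lipschitz estimate covers the unit distance. The
  term \<open>1 / sqrt (norm s)\<close> is a crude majorant of the logarithmic singularity: it is
  integrable along the axis near 0, and with it \<open>q \<ge> 1\<close>, so that constants are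
  absorbed.\<close>

lemma log_series_growth:
  obtains C where "C > 0" "\<And>s. Re s > 0 \<Longrightarrow> norm (log_series s) \<le> C * (sqrt (norm s) + 1 / sqrt (norm s))"
proof -
  obtain C where C: "C > 0" and lip: "\<And>R z w. 0 < Re z \<Longrightarrow> 0 < Re w \<Longrightarrow> norm z \<le> R \<Longrightarrow> norm w \<le> R \<Longrightarrow>
    norm ((log_series z + Ln z) - (log_series w + Ln w)) \<le> C * sqrt (1 + R) * norm (z - w)"
    by (rule log_series_plus_Ln_lipschitz) blast
  define K where "K = \<bar>\<Sum>k. 2 * real (k + 2) powr (-1 - 1)\<bar>"
  have "norm (log_series s) \<le> (3 * C + K + 2 * pi + 6) * (sqrt (norm s) + 1 / sqrt (norm s))" if s: "Re s > 0" for s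
  proof -
    define r where "r = norm s"
    define q where "q = sqrt r + 1 / sqrt r"
    have s1: "s \<noteq> 0" "s + 1 \<noteq> 0" using s by (auto simp: complex_eq_iff)
    then have r: "r > 0" by (simp add: r_def)
    have q: "q \<ge> 1" "sqrt r \<le> q" "1 / sqrt r \<le> q"
    proof -
      show "q \<ge> 1"
      proof (cases "r \<ge> 1")
        case True then show ?thesis unfolding q_def using r by (simp add: add_increasing2)
      next
        case False then show ?thesis unfolding q_def using r by (intro add_increasing) auto
      qed
    qed (use r in \<open>auto simp: q_def\<close>)
    have r1: "norm (s + 1) \<le> r + 1" using norm_triangle_ineq[of s 1] by (simp add: r_def)
    have r2: "norm (s + 1) \<ge> 1" using abs_Re_le_cmod[of "s + 1"] s by simp
    have sq: "sqrt (r + a) \<le> (1 + sqrt a) * q" if "a \<ge> 0" for a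
    proof -
      have "sqrt (r + a) \<le> sqrt r + sqrt a" using r that by (intro sqrt_add_le_add_sqrt) auto
      also have "\<dots> \<le> q + sqrt a * q" using q that by (intro add_mono) (auto simp: mult_le_cancel_left1)
      finally show ?thesis by (simp add: algebra_simps)
    qed
    have 1: "norm ((log_series s + Ln s) - (log_series (s + 1) + Ln (s + 1))) \<le> C * (3 * q)"
    proof -
      have "norm ((log_series s + Ln s) - (log_series (s + 1) + Ln (s + 1))) \<le> C * sqrt (1 + (r + 1)) * norm (s - (s + 1))"
        using s r1 by (intro lip) (auto simp: r_def)
      also have "\<dots> = C * sqrt (r + 2)" by (simp add: add_ac)
      also have "\<dots> \<le> C * ((1 + sqrt 2) * q)" using C by (intro mult_left_mono sq) auto
      also have "\<dots> \<le> C * (3 * q)" using C q by (intro mult_left_mono mult_right_mono) (auto simp: real_le_rsqrt real_le_lsqrt)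
      finally show ?thesis .
    qed
    have 2: "norm (log_series (s + 1)) \<le> K * q"
    proof -
      have "norm (log_series (s + 1)) \<le> K" unfolding K_def
        using norm_log_series_le[of 1 "s + 1"] s by simp
      also have "\<dots> \<le> K * q" using q by (simp add: K_def mult_le_cancel_left1)
      finally show ?thesis .
    qed
    have 3: "norm (Ln (s + 1)) \<le> 4 * q + pi * q"
    proof -
      have "norm (Ln (s + 1)) \<le> \<bar>ln (norm (s + 1))\<bar> + pi" using s1 by (intro norm_Ln_le)
      also have "\<bar>ln (norm (s + 1))\<bar> = ln (norm (s + 1))" using r2 by simp
      also have "\<dots> \<le> 2 * sqrt (norm (s + 1))" using r2 by (intro ln_le_two_sqrt) linarith
      also have "\<dots> \<le> 2 * sqrt (r + 1)" using r1 by simp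
      also have "\<dots> \<le> 4 * q" using sq[of 1] by simp
      finally show ?thesis using q by (smt (verit) mult_le_cancel_left1 pi_gt_zero)
    qed
    have 4: "norm (Ln s) \<le> 2 * q + pi * q"
    proof -
      have "norm (Ln s) \<le> \<bar>ln r\<bar> + pi" using s1 unfolding r_def by (intro norm_Ln_le)
      moreover have "ln r \<le> 2 * q" using ln_le_two_sqrt[OF r] q by linarith
      moreover have "- ln r \<le> 2 * q"
        using ln_le_two_sqrt[of "1 / r"] r q by (simp add: ln_div real_sqrt_divide)
      moreover have "pi \<le> pi * q" using q by simp
      ultimately show ?thesis by linarith
    qed
    have "log_series s = ((log_series s + Ln s) - (log_series (s + 1) + Ln (s + 1))) + log_series (s + 1) + Ln (s + 1) - Ln s"
      by simp
    then have "norm (log_series s) \<le> norm ((log_series s + Ln s) - (log_series (s + 1) + Ln (s + 1)))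
        + norm (log_series (s + 1)) + norm (Ln (s + 1)) + norm (Ln s)"
      by (smt (verit) norm_triangle_ineq norm_triangle_ineq4)
    with 1 2 3 4 have "norm (log_series s) \<le> C * (3 * q) + K * q + (4 * q + pi * q) + (2 * q + pi * q)" by linarith
    also have "\<dots> = (3 * C + K + 2 * pi + 6) * q" by (simp add: algebra_simps)
    finally show ?thesis by (simp add: q_def r_def)
  qed
  moreover have "3 * C + K + 2 * pi + 6 > 0" using C by (simp add: K_def add_pos_nonneg add_nonneg_pos)
  ultimately show ?thesis using that by blast
qed

subsection \<open>Poisson representation\<close>

lemma has_bochner_integral_poisson_kernel:
  assumes "\<sigma> > 0"
  shows "has_bochner_integral lborel (\<lambda>t. poisson_kernel \<sigma> (y - t)) 1"
proof -
  define F where "F t = arctan ((t - y) / \<sigma>) / pi" for t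
  have pos: "\<sigma>\<^sup>2 + (y - t)\<^sup>2 > 0" for t using assms by (intro add_pos_nonneg) auto
  have deriv: "(F has_real_derivative poisson_kernel \<sigma> (y - t)) (at t)" for t
  proof -
    have "(F has_real_derivative inverse (1 + ((t - y) / \<sigma>)\<^sup>2) * (1 / \<sigma>) / pi) (at t)"
      unfolding F_def using assms by (auto intro!: derivative_eq_intros)
    also have "inverse (1 + ((t - y) / \<sigma>)\<^sup>2) * (1 / \<sigma>) / pi = poisson_kernel \<sigma> (y - t)"
    proof -
      have "1 + ((t - y) / \<sigma>)\<^sup>2 = (\<sigma>\<^sup>2 + (y - t)\<^sup>2) / \<sigma>\<^sup>2"
        using assms by (simp add: power_divide add_divide_distrib power2_commute)
      then show ?thesis
        using assms by (simp add: poisson_kernel_def power2_eq_square)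
    qed
    finally show ?thesis .
  qed
  have cont: "isCont (\<lambda>t. poisson_kernel \<sigma> (y - t)) t" for t
    unfolding poisson_kernel_def using pos[of t] by (intro continuous_intros) auto
  have top: "((F \<circ> real_of_ereal) \<longlongrightarrow> 1 / 2) (at_left \<infinity>)"
  proof -
    have "filterlim (\<lambda>t. (t - y) / \<sigma>) at_top at_top" using assms by real_asymp
    from filterlim_compose[OF tendsto_arctan_at_top this]
    have "(F \<longlongrightarrow> (pi / 2) / pi) at_top" unfolding F_def by (intro tendsto_divide) auto
    then show ?thesis by (simp add: ereal_tendsto_simps)
  qed
  have bot: "((F \<circ> real_of_ereal) \<longlongrightarrow> - (1 / 2)) (at_right (-\<infinity>))"
  proof -
    have "filterlim (\<lambda>t. (t - y) / \<sigma>) at_bot at_bot" using assms by real_asymp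
    from filterlim_compose[OF tendsto_arctan_at_bot this]
    have "(F \<longlongrightarrow> (- (pi / 2)) / pi) at_bot" unfolding F_def by (intro tendsto_divide) auto
    then show ?thesis by (simp add: ereal_tendsto_simps)
  qed
  have nonneg: "AE t in lborel. - \<infinity> < ereal t \<longrightarrow> ereal t < \<infinity> \<longrightarrow> 0 \<le> poisson_kernel \<sigma> (y - t)"
    using assms by (simp add: poisson_kernel_def)
  \<comment> \<open>For a nonnegative integrand the limits of the antiderivative yield integrability
    together with the value.\<close>
  note FTC = interval_integral_FTC_nonneg[of "-\<infinity>" \<infinity> F "\<lambda>t. poisson_kernel \<sigma> (y - t)", OF _ deriv cont nonneg bot top]
  have "integrable lborel (\<lambda>t. poisson_kernel \<sigma> (y - t))"
    using FTC(1) by (simp add: set_integrable_def)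
  moreover have "(LINT t|lborel. poisson_kernel \<sigma> (y - t)) = 1"
    using FTC(2) by (simp add: interval_lebesgue_integral_def set_lebesgue_integral_def)
  ultimately show ?thesis by (simp add: has_bochner_integral_iff)
qed

text \<open>This links the gauge integrals over the diameters of half-discs, which come from contour
  integration, with the Lebesgue integral over the line.\<close>

lemma tendsto_integral_symmetric_interval:
  fixes f :: "real \<Rightarrow> 'a::euclidean_space"
  assumes f: "integrable lborel f"
  shows "(\<lambda>n. integral {- real n..real n} f) \<longlonglongrightarrow> integral\<^sup>L lborel f"
proof -
  have "(\<lambda>n. LINT t|lborel. indicator {- real n..real n} t *\<^sub>R f t) \<longlonglongrightarrow> integral\<^sup>L lborel f"
  proof (rule integral_dominated_convergence[where w = "\<lambda>t. norm (f t)"])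
    show "AE t in lborel. (\<lambda>n. indicator {- real n..real n} t *\<^sub>R f t) \<longlonglongrightarrow> f t"
    proof (rule AE_I2)
      fix t :: real
      have "\<forall>\<^sub>F n in sequentially. \<bar>t\<bar> \<le> real n"
        using filterlim_real_sequentially unfolding filterlim_at_top by blast
      then show "(\<lambda>n. indicator {- real n..real n} t *\<^sub>R f t) \<longlonglongrightarrow> f t"
        by (intro tendsto_eventually, elim eventually_mono) (auto simp: indicator_def)
    qed
    show "f \<in> borel_measurable lborel" using f by simp
    then show "(\<lambda>t. indicator {- real n..real n} t *\<^sub>R f t) \<in> borel_measurable lborel" for n
      by measurable
  qed (use f in \<open>auto simp: indicator_def\<close>)
  moreover have "(LINT t|lborel. indicator {- real n..real n} t *\<^sub>R f t) = integral {- real n..real n} f" for n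
  proof -
    have "set_integrable lborel {- real n..real n} f"
      unfolding set_integrable_def using f by (intro integrable_mult_indicator) auto
    from set_borel_integral_eq_integral(2)[OF this] show ?thesis
      by (simp add: set_lebesgue_integral_def)
  qed
  ultimately show ?thesis by simp
qed

text \<open>Cauchy's theorem on half-discs, applied to
  \<open>(f w - f s) / ((w - s) * (w + cnj s))\<close>, whose singularity at \<open>s\<close> is removable and whose
  restriction to the imaginary axis is \<open>f w - f s\<close> times a multiple of the Poisson kernel.\<close>

lemma poisson_representation_bounded:
  assumes hol: "f holomorphic_on {z. Re z > - \<delta>}" and \<delta>: "\<delta> > 0"
    and bounded: "\<And>z. Re z \<ge> 0 \<Longrightarrow> norm (f z) \<le> B" and s: "Re s > 0"
  shows "has_bochner_integral lborel
           (\<lambda>t. poisson_kernel (Re s) (Im s - t) *\<^sub>R f (Complex 0 t)) (f s)"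
proof -
  \<comment> \<open>The bound by \<open>Re s\<close> keeps the pole \<open>- cnj s\<close>, the
    reflection of \<open>s\<close> in the imaginary axis, outside \<open>S\<close>; the bound by
    \<open>\<delta>\<close> keeps \<open>S\<close> inside the domain of \<open>f\<close>.\<close>
  define \<eta> where "\<eta> = min \<delta> (Re s)"
  define S where "S = {z. Re z > - \<eta>}"
  have \<eta>: "\<eta> > 0" using \<delta> s by (simp add: \<eta>_def)
  have S: "convex S" "open S" "s \<in> S" "S \<subseteq> {z. Re z > - \<delta>}"
    using s \<eta> by (auto simp: S_def \<eta>_def convex_halfspace_Re_gt open_halfspace_Re_gt)
  have nz: "w + cnj s \<noteq> 0" if "w \<in> S" for w
    using that by (auto simp: S_def \<eta>_def complex_eq_iff)
  have B: "B \<ge> 0" using order_trans[OF norm_ge_zero bounded[of 0]] by simp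
  define \<phi> where "\<phi> w = (if w = s then deriv f s else (f w - f s) / (w - s)) / (w + cnj s)" for w
  have hol\<phi>: "\<phi> holomorphic_on S"
    unfolding \<phi>_def
    by (intro holomorphic_intros pole_lemma holomorphic_on_subset[OF hol S(4)] nz)
       (use S in \<open>auto simp: interior_open\<close>)
  define P where "P t = poisson_kernel (Re s) (Im s - t)" for t
  have P: "has_bochner_integral lborel P 1"
    unfolding P_def by (rule has_bochner_integral_poisson_kernel[OF s])
  have P0: "P t \<ge> 0" for t using s by (simp add: P_def poisson_kernel_def)
  define G where "G t = P t *\<^sub>R (f (Complex 0 t) - f s)" for t
  have \<phi>_line: "\<phi> (Complex 0 t) = - of_real (pi / Re s) * G t" for t
  proof -
    have ne: "Complex 0 t \<noteq> s" using s by auto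
    have "(Complex 0 t - s) * (Complex 0 t + cnj s) = - of_real ((Re s)\<^sup>2 + (Im s - t)\<^sup>2)"
      by (simp add: complex_eq_iff power2_eq_square algebra_simps)
    moreover have "\<phi> (Complex 0 t) = (f (Complex 0 t) - f s) / ((Complex 0 t - s) * (Complex 0 t + cnj s))"
      using ne by (simp add: \<phi>_def)
    moreover have "- of_real (pi / Re s) * G t = (f (Complex 0 t) - f s) / (- of_real ((Re s)\<^sup>2 + (Im s - t)\<^sup>2))"
    proof -
      have "pi / Re s * P t = 1 / ((Re s)\<^sup>2 + (Im s - t)\<^sup>2)"
        using s by (simp add: P_def poisson_kernel_def)
      moreover have "- of_real (pi / Re s) * G t = - of_real (pi / Re s * P t) * (f (Complex 0 t) - f s)"
        by (simp add: G_def scaleR_conv_of_real)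
      ultimately have "- of_real (pi / Re s) * G t = - of_real (1 / ((Re s)\<^sup>2 + (Im s - t)\<^sup>2)) * (f (Complex 0 t) - f s)"
        by (simp only:)
      then show ?thesis by (simp only: of_real_divide of_real_1 divide_minus_right) simp
    qed
    ultimately show ?thesis by simp
  qed
  have cont: "continuous_on UNIV (\<lambda>t. f (Complex 0 t))"
  proof (rule continuous_on_compose2[OF holomorphic_on_imp_continuous_on[OF hol]])
    show "continuous_on UNIV (Complex 0)"
      unfolding Complex_eq by (intro continuous_intros)
  qed (use \<delta> in auto)
  then have meas: "(\<lambda>t. f (Complex 0 t)) \<in> borel_measurable lborel"
    using borel_measurable_continuous_onI by simp
  have int_P: "integrable lborel P" "integral\<^sup>L lborel P = 1"
    using P by (auto simp: has_bochner_integral_iff)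
  have int_Pf: "integrable lborel (\<lambda>t. P t *\<^sub>R f (Complex 0 t))"
  proof (rule Bochner_Integration.integrable_bound[where f = "\<lambda>t. B * P t"])
    show "(\<lambda>t. P t *\<^sub>R f (Complex 0 t)) \<in> borel_measurable lborel"
      using borel_measurable_integrable[OF int_P(1)] meas by measurable
    show "AE t in lborel. norm (P t *\<^sub>R f (Complex 0 t)) \<le> norm (B * P t)"
      using P0 B bounded by (auto simp: mult.commute[of B] intro!: mult_left_mono)
  qed (use int_P in auto)
  have int_Ps: "integrable lborel (\<lambda>t. P t *\<^sub>R f s)"
    using int_P by (intro integrable_scaleR_left) auto
  have G_eq: "G = (\<lambda>t. P t *\<^sub>R f (Complex 0 t) - P t *\<^sub>R f s)"
    by (simp add: G_def fun_eq_iff scaleR_diff_right)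
  have int_G: "integrable lborel G" unfolding G_eq using int_Pf int_Ps by simp
  have lim1: "(\<lambda>n. integral {- real n..real n} G) \<longlonglongrightarrow> integral\<^sup>L lborel G"
    by (rule tendsto_integral_symmetric_interval[OF int_G])
  have bound: "norm (integral {- R..R} G) \<le> Re s / pi * (2 * B / (R - norm s)\<^sup>2 * R * pi)" if R: "R > norm s" for R
  proof -
    have R0: "R > 0" using R norm_ge_zero[of s] by linarith
    define arc where "arc = part_circlepath 0 R (pi / 2) (- (pi / 2))"
    define seg where "seg = linepath (Complex 0 (- R)) (Complex 0 R)"
    have ends: "pathfinish arc = pathstart seg" "pathstart arc = pathfinish seg"
    proof -
      have e: "exp (\<i> * complex_of_real (pi / 2)) = \<i>" "exp (\<i> * complex_of_real (- (pi / 2))) = - \<i>"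
        by (simp_all only: cis_conv_exp[symmetric]) (simp_all add: complex_eq_iff)
      show "pathfinish arc = pathstart seg" "pathstart arc = pathfinish seg"
        unfolding arc_def seg_def
        by (simp_all only: pathfinish_part_circlepath pathstart_part_circlepath pathfinish_linepath pathstart_linepath e)
          (simp_all add: complex_eq_iff)
    qed
    have arc: "norm w = R \<and> Re w \<ge> 0" if "w \<in> path_image arc" for w
    proof -
      from that obtain \<theta> where "\<theta> \<in> closed_segment (pi / 2) (- (pi / 2))" "w = of_real R * cis \<theta>"
        unfolding arc_def path_image_part_circlepath' by auto
      then have "- (pi / 2) \<le> \<theta>" "\<theta> \<le> pi / 2" "w = of_real R * cis \<theta>"
        by (auto simp: closed_segment_eq_real_ivl split: if_splits)
      then show ?thesis using R0 cos_ge_zero[of \<theta>] by (simp add: norm_mult)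
    qed
    have arc_S: "path_image arc \<subseteq> S" using arc \<eta> by (force simp: S_def)
    have seg_S: "path_image seg \<subseteq> S"
      unfolding seg_def using S(1) \<eta> by (simp add: closed_segment_subset S_def)
    have int: "\<phi> contour_integrable_on arc" "\<phi> contour_integrable_on seg"
      unfolding arc_def seg_def
      using holomorphic_on_imp_continuous_on[OF hol\<phi>] arc_S seg_S
      by (auto intro!: contour_integrable_continuous_part_circlepath contour_integrable_continuous_linepath
               intro: continuous_on_subset simp: arc_def seg_def)
    have "(\<phi> has_contour_integral 0) (arc +++ seg)"
      by (rule Cauchy_theorem_convex_simple[OF hol\<phi> S(1)])
         (use arc_S seg_S ends in \<open>auto simp: arc_def seg_def path_image_join\<close>)
    then have "contour_integral arc \<phi> + contour_integral seg \<phi> = 0"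
      using int contour_integral_join[of \<phi> arc seg] contour_integral_unique
      by (simp add: arc_def seg_def)
    moreover have "contour_integral seg \<phi> = \<i> * integral {- R..R} (\<lambda>t. \<phi> (Complex 0 t))"
      unfolding seg_def by (rule contour_integral_linepath_same_Re) (use R0 in auto)
    ultimately have "norm (integral {- R..R} (\<lambda>t. \<phi> (Complex 0 t))) = norm (contour_integral arc \<phi>)"
      by (metis add_eq_0_iff norm_ii norm_minus_cancel norm_mult mult_1)
    \<comment> \<open>On the arc both factors of the denominator are at least
      \<open>R - norm s\<close>. The integrand is thus of order 1/R^2 on an arc of length
      \<open>R * pi\<close>, and the contribution vanishes in the limit.\<close>
    also have "\<dots> \<le> 2 * B / (R - norm s)\<^sup>2 * R * \<bar>- (pi / 2) - pi / 2\<bar>"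
      unfolding arc_def
    proof (rule contour_integral_bound_part_circlepath)
      fix w assume "w \<in> path_image (part_circlepath 0 R (pi / 2) (- (pi / 2)))"
      then have w: "norm w = R" "Re w \<ge> 0" using arc by (auto simp: arc_def)
      have "norm (f w - f s) \<le> 2 * B"
        using bounded[of w] bounded[of s] w s norm_triangle_ineq4[of "f w" "f s"] by linarith
      moreover have "R - norm s \<le> norm (w - s)" using w norm_triangle_ineq2[of w s] by simp
      moreover have "R - norm s \<le> norm (w + cnj s)"
        using w norm_triangle_ineq2[of w "- cnj s"] by simp
      moreover have "w \<noteq> s" using w R by auto
      moreover from \<open>w \<noteq> s\<close> have "norm (\<phi> w) = norm (f w - f s) / (norm (w - s) * norm (w + cnj s))"
        by (simp add: \<phi>_def norm_divide norm_mult)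
      ultimately show "norm (\<phi> w) \<le> 2 * B / (R - norm s)\<^sup>2"
        unfolding power2_eq_square using R B by (simp only:) (intro frac_le mult_mono mult_pos_pos; simp)
    qed (use int B R0 in \<open>auto simp: arc_def\<close>)
    finally have *: "norm (integral {- R..R} (\<lambda>t. \<phi> (Complex 0 t))) \<le> 2 * B / (R - norm s)\<^sup>2 * R * pi"
      by simp
    have "integral {- R..R} (\<lambda>t. \<phi> (Complex 0 t)) = - of_real (pi / Re s) * integral {- R..R} G"
      unfolding \<phi>_line by (rule integral_mult_right)
    then have "norm (integral {- R..R} (\<lambda>t. \<phi> (Complex 0 t))) = pi / Re s * norm (integral {- R..R} G)"
      using s by (simp add: norm_mult norm_divide)
    with * have "pi / Re s * norm (integral {- R..R} G) \<le> 2 * B / (R - norm s)\<^sup>2 * R * pi" by simp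
    from mult_left_mono[OF this, of "Re s / pi"] s show ?thesis by simp
  qed
  have "(\<lambda>n. integral {- real n..real n} G) \<longlonglongrightarrow> 0"
  proof (rule Lim_null_comparison)
    show "\<forall>\<^sub>F n in sequentially. norm (integral {- real n..real n} G) \<le> Re s / pi * (2 * B / (real n - norm s)\<^sup>2 * real n * pi)"
      using eventually_compose_filterlim[OF eventually_gt_at_top[of "norm s"] filterlim_real_sequentially]
      by eventually_elim (rule bound)
    show "(\<lambda>n. Re s / pi * (2 * B / (real n - norm s)\<^sup>2 * real n * pi)) \<longlonglongrightarrow> 0"
      by real_asymp
  qed
  \<comment> \<open>As the kernel has total mass 1, the vanishing of this integral is the Poisson
    formula at \<open>s\<close>.\<close>
  with lim1 have "integral\<^sup>L lborel G = 0" by (rule LIMSEQ_unique)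
  then have "integral\<^sup>L lborel (\<lambda>t. P t *\<^sub>R f (Complex 0 t)) = integral\<^sup>L lborel (\<lambda>t. P t *\<^sub>R f s)"
    unfolding G_eq using int_Pf int_Ps by simp
  also have "\<dots> = f s" using int_P by simp
  finally show ?thesis using int_Pf by (simp add: has_bochner_integral_iff P_def)
qed

section \<open>Existence and measurability of the boundary values\<close>

text \<open>The definite description in \<open>boundary_value\<close> needs uniqueness: the Stolz
  region of aperture 1 accumulates at the boundary point, through the points
  \<open>Complex (e / 2) t\<close>, so a limit along it is unique.\<close>

lemma nontangential_limit_of_unrestricted_limit:
  assumes "(g \<longlongrightarrow> l) (at (Complex 0 t) within right_half_plane)"
  shows "has_nontangential_limit g t l" "boundary_value g t = l"
proof -
  show lim: "has_nontangential_limit g t l"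
    unfolding has_nontangential_limit_def
    by (intro allI impI tendsto_within_subset[OF assms]) (auto simp: stolz_region_def right_half_plane_def)
  show "boundary_value g t = l"
    unfolding boundary_value_def
  proof (rule the_equality, rule lim)
    fix l' assume l': "has_nontangential_limit g t l'"
    have "Complex 0 t islimpt stolz_region 1 t"
      unfolding islimpt_approachable
    proof (intro allI impI)
      fix e :: real assume "e > 0"
      then show "\<exists>x'\<in>stolz_region 1 t. x' \<noteq> Complex 0 t \<and> dist x' (Complex 0 t) < e"
        by (intro bexI[of _ "Complex (e / 2) t"]) (auto simp: stolz_region_def dist_complex_def cmod_def)
    qed
    then have "\<not> trivial_limit (at (Complex 0 t) within stolz_region 1 t)"
      by (simp add: trivial_limit_within)
    then show "l' = l"
      using lim l' unfolding has_nontangential_limit_def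
      by (intro tendsto_unique[of "at (Complex 0 t) within stolz_region 1 t" g l' l]) auto
  qed
qed

lemma log_series_boundary:
  assumes "t \<noteq> 0"
  shows "(log_series \<longlongrightarrow> boundary_value log_series t) (at (Complex 0 t) within right_half_plane)"
    and "has_nontangential_limit log_series t (boundary_value log_series t)"
proof -
  obtain l where l: "(log_series \<longlongrightarrow> l) (at (Complex 0 t) within right_half_plane)"
    using log_series_limit[OF assms] by blast
  then show "(log_series \<longlongrightarrow> boundary_value log_series t) (at (Complex 0 t) within right_half_plane)"
    and "has_nontangential_limit log_series t (boundary_value log_series t)"
    using nontangential_limit_of_unrestricted_limit[OF l] by auto
qed

lemma tendsto_inverse_Suc: "(\<lambda>k. 1 / real (Suc k)) \<longlonglongrightarrow> 0"
  using LIMSEQ_inverse_real_of_nat by (simp add: inverse_eq_divide)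

text \<open>A countable approach to the boundary, as required for measurability, dominated
  convergence and Fatou's lemma.\<close>

lemma log_series_boundary_sequence:
  assumes "t \<noteq> 0"
  shows "(\<lambda>k. log_series (Complex (1 / real (Suc k)) t)) \<longlonglongrightarrow> boundary_value log_series t"
proof (rule filterlim_compose[OF log_series_boundary(1)[OF assms]])
  have "(\<lambda>k. Complex (1 / real (Suc k)) t) \<longlonglongrightarrow> Complex 0 t"
    by (intro tendsto_Complex tendsto_inverse_Suc tendsto_const)
  then show "filterlim (\<lambda>k. Complex (1 / real (Suc k)) t) (at (Complex 0 t) within right_half_plane) sequentially"
    unfolding filterlim_at by (auto simp: right_half_plane_def)
qed

lemma AE_nonzero: "AE t in lborel. t \<noteq> (0::real)"
  by (rule AE_lborel_singleton)

lemma log_series_holomorphic: "log_series holomorphic_on {s. Re s > 0}"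
  using log_series_derivative(2)
  by (auto simp: holomorphic_on_def field_differentiable_def intro: has_field_derivative_at_within)

lemma continuous_on_Complex_right: "continuous_on A (Complex x)"
  unfolding Complex_eq by (intro continuous_intros)

lemma log_series_vertical_measurable:
  assumes "\<epsilon> > 0"
  shows "(\<lambda>t. log_series (Complex \<epsilon> t)) \<in> borel_measurable lborel"
proof -
  have "continuous_on UNIV (\<lambda>t. log_series (Complex \<epsilon> t))"
    by (rule continuous_on_compose2[OF holomorphic_on_imp_continuous_on[OF log_series_holomorphic]
          continuous_on_Complex_right]) (use assms in auto)
  then show ?thesis using borel_measurable_continuous_onI by simp
qed

text \<open>Convergence is available only for \<open>t \<noteq> 0\<close>. Setting all functions to
  0 at that one point gives a limit everywhere, and restoring a single value preserves
  measurability.\<close>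

lemma boundary_value_log_series_measurable [measurable]:
  "boundary_value log_series \<in> borel_measurable borel"
proof -
  define F where "F k t = (if t = 0 then 0 else log_series (Complex (1 / real (Suc k)) t))" for k t
  define G where "G t = (if t = 0 then 0 else boundary_value log_series t)" for t
  have [measurable]: "(\<lambda>t. log_series (Complex (1 / real (Suc k)) t)) \<in> borel_measurable borel" for k
    using log_series_vertical_measurable[of "1 / real (Suc k)"] by simp
  have [measurable]: "G \<in> borel_measurable borel"
  proof (rule borel_measurable_LIMSEQ_metric)
    show "F k \<in> borel_measurable borel" for k unfolding F_def by measurable
    show "(\<lambda>k. F k t) \<longlonglongrightarrow> G t" for t
      using log_series_boundary_sequence[of t] by (cases "t = 0") (auto simp: F_def G_def)
  qed
  have "(\<lambda>t. if t = 0 then boundary_value log_series 0 else G t) \<in> borel_measurable borel"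
    by measurable
  also have "(\<lambda>t. if t = 0 then boundary_value log_series 0 else G t) = boundary_value log_series"
    by (auto simp: G_def)
  finally show ?thesis .
qed

section \<open>Integrable majorants and the limit of the Poisson integrals\<close>

lemma integrable_powr_weight:
  "integrable lborel (\<lambda>t::real. indicator {0..1} t * t powr (- 1 / 2) + indicator {1..} t * t powr (- 3 / 2))"
proof (rule Bochner_Integration.integrable_add)
  have *: "integrable lborel (\<lambda>t. indicator A t * t powr a)"
    if "((\<lambda>t. t powr a) has_integral I) A" "A \<in> sets borel" for A and a I :: real
  proof (rule integrableI_nonneg)
    have "(\<integral>\<^sup>+t. ennreal (indicator A t * t powr a) \<partial>lborel) = ennreal I"
      by (rule nn_integral_has_integral_lebesgue[OF _ that(1)]) simp
    then show "(\<integral>\<^sup>+t. ennreal (indicator A t * t powr a) \<partial>lborel) < \<infinity>" by simp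
  qed (use that(2) in auto)
  show "integrable lborel (\<lambda>t::real. indicator {0..1} t * t powr (- 1 / 2))"
    by (rule *[OF has_integral_powr_from_0]) auto
  show "integrable lborel (\<lambda>t::real. indicator {1..} t * t powr (- 3 / 2))"
    by (rule *[OF has_integral_powr_to_inf]) auto
qed

text \<open>The weight is of order \<open>x powr (- 1 / 2)\<close> near 0 and
  \<open>x powr (- 3 / 2)\<close> at infinity, with \<open>x = \<bar>t\<bar>\<close>. The factor 3
  arises as \<open>2 + 1 / sqrt x \<le> 3 / sqrt x\<close> for \<open>x \<le> 1\<close>, and as
  \<open>2 * sqrt x + sqrt x\<close> in the numerator beyond.\<close>

lemma integrable_growth_weight:
  "integrable lborel (\<lambda>t::real. (sqrt (1 + \<bar>t\<bar>) + 1 / sqrt \<bar>t\<bar>) / (1 + t\<^sup>2))"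
proof -
  define m where "m t = indicator {0..1} t * t powr (- 1 / 2) + indicator {1..} t * t powr (- 3 / 2)" for t :: real
  have m: "integrable lborel m" unfolding m_def by (rule integrable_powr_weight)
  have m0: "m t \<ge> 0" for t by (simp add: m_def)
  have "integrable lborel (\<lambda>t. m (0 + (-1) * t))" by (rule lborel_integrable_real_affine[OF m]) simp
  then have int: "integrable lborel (\<lambda>t. 3 * (m t + m (- t)))" using m by simp
  have *: "(sqrt (1 + x) + 1 / sqrt x) / (1 + x\<^sup>2) \<le> 3 * m x" if x: "x > 0" for x
  proof (cases "x \<le> 1")
    case True
    have r: "0 < sqrt x" "sqrt x \<le> 1" using x True by auto
    have "(sqrt (1 + x) + 1 / sqrt x) / (1 + x\<^sup>2) \<le> (2 + 1 / sqrt x) / 1"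
      using x True by (intro frac_le add_mono real_le_lsqrt) auto
    also have "\<dots> \<le> 3 * (1 / sqrt x)" using r by (simp add: field_simps)
    also have "\<dots> = 3 * x powr (- 1 / 2)"
      using x by (simp add: powr_minus_divide powr_half_sqrt)
    also have "\<dots> \<le> 3 * m x" using True x by (simp add: m_def)
    finally show ?thesis .
  next
    case False
    have r: "sqrt x \<ge> 1" using False by simp
    have "sqrt (1 + x) \<le> sqrt (4 * x)" using False by simp
    also have "\<dots> = 2 * sqrt x" by (simp add: real_sqrt_mult)
    finally have "sqrt (1 + x) \<le> 2 * sqrt x" .
    moreover have "1 / sqrt x \<le> sqrt x" using r by (simp add: field_simps flip: power2_eq_square)
    ultimately have "(sqrt (1 + x) + 1 / sqrt x) / (1 + x\<^sup>2) \<le> (3 * sqrt x) / x\<^sup>2"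
      using x by (intro frac_le) auto
    also have "\<dots> = 3 * x powr (- 3 / 2)"
    proof -
      have "x powr (- 3 / 2) * x powr 2 = x powr (1 / 2)" by (simp flip: powr_add)
      then show ?thesis using x by (simp add: powr_half_sqrt field_simps)
    qed
    also have "\<dots> \<le> 3 * m x" using False by (simp add: m_def)
    finally show ?thesis .
  qed
  show ?thesis
  proof (rule Bochner_Integration.integrable_bound[OF int])
    show "AE t in lborel. norm ((sqrt (1 + \<bar>t\<bar>) + 1 / sqrt \<bar>t\<bar>) / (1 + t\<^sup>2)) \<le> norm (3 * (m t + m (- t)))"
      using AE_nonzero
    proof eventually_elim
      case (elim t)
      have "(sqrt (1 + \<bar>t\<bar>) + 1 / sqrt \<bar>t\<bar>) / (1 + t\<^sup>2) \<le> 3 * m \<bar>t\<bar>"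
        using *[of "\<bar>t\<bar>"] elim by simp
      also have "\<dots> \<le> 3 * (m t + m (- t))" using m0[of t] m0[of "- t"] by (simp add: abs_if)
      finally show ?case using m0 by (simp add: add_nonneg_nonneg)
    qed
  qed measurable
qed

lemma integrable_poisson_growth:
  assumes "\<sigma> > 0"
  shows "integrable lborel (\<lambda>t. poisson_kernel \<sigma> (y - t) * (sqrt (1 + \<bar>t\<bar>) + 1 / sqrt \<bar>t\<bar>))"
proof -
  \<comment> \<open>The two summands come from \<open>1 + t\<^sup>2 \<le> (1 + 2 * y\<^sup>2) + 2 *
    (y - t)\<^sup>2\<close>, with each part bounded by a multiple of
    \<open>\<sigma>\<^sup>2 + (y - t)\<^sup>2\<close>.\<close>
  define K where "K = (1 + 2 * y\<^sup>2) / \<sigma>\<^sup>2 + 2"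
  have K: "poisson_kernel \<sigma> (y - t) \<le> \<sigma> * K / pi * (1 / (1 + t\<^sup>2))" for t
  proof -
    have "0 \<le> (t - 2 * y)\<^sup>2" by simp
    then have "1 + t\<^sup>2 \<le> (1 + 2 * y\<^sup>2) + 2 * (y - t)\<^sup>2"
      by (simp add: power2_eq_square algebra_simps)
    also have "\<dots> \<le> (1 + 2 * y\<^sup>2) / \<sigma>\<^sup>2 * (\<sigma>\<^sup>2 + (y - t)\<^sup>2) + 2 * (\<sigma>\<^sup>2 + (y - t)\<^sup>2)"
      using assms by (intro add_mono) (auto simp: distrib_left)
    also have "\<dots> = K * (\<sigma>\<^sup>2 + (y - t)\<^sup>2)" by (simp add: K_def distrib_right)
    finally have "1 + t\<^sup>2 \<le> K * (\<sigma>\<^sup>2 + (y - t)\<^sup>2)" .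
    moreover have "\<sigma>\<^sup>2 + (y - t)\<^sup>2 > 0" "1 + t\<^sup>2 > 0" using assms by (auto intro: add_pos_nonneg)
    ultimately have "1 / (\<sigma>\<^sup>2 + (y - t)\<^sup>2) \<le> K / (1 + t\<^sup>2)" by (simp add: field_simps)
    from mult_left_mono[OF this, of "\<sigma> / pi"] assms show ?thesis by (simp add: poisson_kernel_def)
  qed
  show ?thesis
  proof (rule Bochner_Integration.integrable_bound)
    show "integrable lborel (\<lambda>t. \<sigma> * K / pi * ((sqrt (1 + \<bar>t\<bar>) + 1 / sqrt \<bar>t\<bar>) / (1 + t\<^sup>2)))"
      using integrable_growth_weight by (rule integrable_mult_right)
    show "AE t in lborel. norm (poisson_kernel \<sigma> (y - t) * (sqrt (1 + \<bar>t\<bar>) + 1 / sqrt \<bar>t\<bar>))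
        \<le> norm (\<sigma> * K / pi * ((sqrt (1 + \<bar>t\<bar>) + 1 / sqrt \<bar>t\<bar>) / (1 + t\<^sup>2)))"
    proof (rule AE_I2)
      fix t
      have "norm (poisson_kernel \<sigma> (y - t) * (sqrt (1 + \<bar>t\<bar>) + 1 / sqrt \<bar>t\<bar>))
          = poisson_kernel \<sigma> (y - t) * (sqrt (1 + \<bar>t\<bar>) + 1 / sqrt \<bar>t\<bar>)"
        using assms by (simp add: poisson_kernel_def)
      also have "\<dots> \<le> \<sigma> * K / pi * (1 / (1 + t\<^sup>2)) * (sqrt (1 + \<bar>t\<bar>) + 1 / sqrt \<bar>t\<bar>)"
        by (intro mult_right_mono K) auto
      also have "\<dots> = \<sigma> * K / pi * ((sqrt (1 + \<bar>t\<bar>) + 1 / sqrt \<bar>t\<bar>) / (1 + t\<^sup>2))" by simp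
      also have "\<dots> \<le> norm \<dots>" unfolding real_norm_def by (rule abs_ge_self)
      finally show "norm (poisson_kernel \<sigma> (y - t) * (sqrt (1 + \<bar>t\<bar>) + 1 / sqrt \<bar>t\<bar>))
          \<le> norm (\<sigma> * K / pi * ((sqrt (1 + \<bar>t\<bar>) + 1 / sqrt \<bar>t\<bar>) / (1 + t\<^sup>2)))" .
    qed
  qed (simp add: poisson_kernel_def)
qed

lemma log_series_poisson:
  assumes s: "Re s > 0"
  shows "has_bochner_integral lborel
    (\<lambda>t. poisson_kernel (Re s) (Im s - t) *\<^sub>R boundary_value log_series t) (log_series s)"
proof -
  define P where "P t = poisson_kernel (Re s) (Im s - t)" for t
  have P0: "P t \<ge> 0" for t using s by (simp add: P_def poisson_kernel_def)
  have [measurable]: "P \<in> borel_measurable borel" unfolding P_def poisson_kernel_def by measurable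
  define \<epsilon> where "\<epsilon> k = 1 / real (Suc k)" for k
  have \<epsilon>: "\<epsilon> k > 0" "\<epsilon> k \<le> 1" for k by (auto simp: \<epsilon>_def)
  have [measurable]: "(\<lambda>t. log_series (Complex (\<epsilon> k) t)) \<in> borel_measurable borel" for k
    using log_series_vertical_measurable[OF \<epsilon>(1)[of k]] by simp
  obtain C where C: "C > 0" "\<And>s. Re s > 0 \<Longrightarrow> norm (log_series s) \<le> C * (sqrt (norm s) + 1 / sqrt (norm s))"
    by (rule log_series_growth) blast
  \<comment> \<open>The translate by \<open>\<epsilon> k\<close> is holomorphic across the imaginary
    axis and bounded on the closed half-plane, so the representation for bounded functions applies
    to it.\<close>
  have shifted: "has_bochner_integral lborel (\<lambda>t. P t *\<^sub>R log_series (Complex (\<epsilon> k) t)) (log_series (s + of_real (\<epsilon> k)))" for k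
  proof -
    have "has_bochner_integral lborel
       (\<lambda>t. poisson_kernel (Re s) (Im s - t) *\<^sub>R log_series (Complex 0 t + of_real (\<epsilon> k))) (log_series (s + of_real (\<epsilon> k)))"
    proof (rule poisson_representation_bounded[where f = "\<lambda>z. log_series (z + of_real (\<epsilon> k))" and \<delta> = "\<epsilon> k"
            and B = "\<Sum>j. 2 * real (j + 2) powr (-1 - \<epsilon> k)", OF _ \<epsilon>(1) _ s])
      show "(\<lambda>z. log_series (z + of_real (\<epsilon> k))) holomorphic_on {z. - \<epsilon> k < Re z}"
        by (rule holomorphic_on_compose_gen[OF _ log_series_holomorphic, unfolded o_def])
          (auto intro!: holomorphic_intros)
      show "norm (log_series (z + of_real (\<epsilon> k))) \<le> (\<Sum>j. 2 * real (j + 2) powr (-1 - \<epsilon> k))" if "0 \<le> Re z" for z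
        using that by (intro norm_log_series_le \<epsilon>) auto
    qed
    moreover have "Complex 0 t + of_real (\<epsilon> k) = Complex (\<epsilon> k) t" for t
      by (simp add: complex_eq_iff)
    ultimately show ?thesis by (simp add: P_def)
  qed
  \<comment> \<open>The majorant is free of \<open>k\<close> because
    \<open>\<bar>t\<bar> \<le> norm z \<le> 1 + \<bar>t\<bar>\<close>; the lower bound serves the
    singular term, the upper one the growing term.\<close>
  have dominated: "norm (P t *\<^sub>R log_series (Complex (\<epsilon> k) t)) \<le> C * (P t * (sqrt (1 + \<bar>t\<bar>) + 1 / sqrt \<bar>t\<bar>))"
    if t: "t \<noteq> 0" for k t
  proof -
    define z where "z = Complex (\<epsilon> k) t"
    have "norm z \<le> 1 + \<bar>t\<bar>"
      using cmod_le[of z] \<epsilon>[of k] by (simp add: z_def)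
    moreover have "\<bar>t\<bar> \<le> norm z" using abs_Im_le_cmod[of z] by (simp add: z_def)
    ultimately have "sqrt (norm z) + 1 / sqrt (norm z) \<le> sqrt (1 + \<bar>t\<bar>) + 1 / sqrt \<bar>t\<bar>"
      using t by (intro add_mono divide_left_mono mult_pos_pos) auto
    moreover have "norm (log_series z) \<le> C * (sqrt (norm z) + 1 / sqrt (norm z))"
      using \<epsilon>[of k] by (intro C) (simp add: z_def)
    ultimately have "norm (log_series z) \<le> C * (sqrt (1 + \<bar>t\<bar>) + 1 / sqrt \<bar>t\<bar>)"
      using C(1) by (meson mult_left_mono less_imp_le order_trans)
    from mult_left_mono[OF this P0[of t]] P0[of t] show ?thesis
      by (simp add: z_def mult_ac)
  qed
  have w: "integrable lborel (\<lambda>t. C * (P t * (sqrt (1 + \<bar>t\<bar>) + 1 / sqrt \<bar>t\<bar>)))"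
    using integrable_poisson_growth[OF s] unfolding P_def by (intro integrable_mult_right)
  have lim: "AE t in lborel. (\<lambda>k. P t *\<^sub>R log_series (Complex (\<epsilon> k) t)) \<longlonglongrightarrow> P t *\<^sub>R boundary_value log_series t"
    using AE_nonzero
    by eventually_elim (auto intro!: tendsto_scaleR log_series_boundary_sequence simp: \<epsilon>_def simp del: of_nat_Suc)
  have bound: "AE t in lborel. norm (P t *\<^sub>R log_series (Complex (\<epsilon> k) t)) \<le> C * (P t * (sqrt (1 + \<bar>t\<bar>) + 1 / sqrt \<bar>t\<bar>))" for k
    using AE_nonzero by eventually_elim (rule dominated)
  have meas: "(\<lambda>t. P t *\<^sub>R boundary_value log_series t) \<in> borel_measurable lborel"
    "(\<lambda>t. P t *\<^sub>R log_series (Complex (\<epsilon> k) t)) \<in> borel_measurable lborel" for k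
    by measurable
  have "(\<lambda>k. LINT t|lborel. P t *\<^sub>R log_series (Complex (\<epsilon> k) t)) \<longlonglongrightarrow> (LINT t|lborel. P t *\<^sub>R boundary_value log_series t)"
    by (rule integral_dominated_convergence[OF meas w lim bound])
  moreover have "(LINT t|lborel. P t *\<^sub>R log_series (Complex (\<epsilon> k) t)) = log_series (s + of_real (\<epsilon> k))" for k
    using shifted by (simp add: has_bochner_integral_iff)
  moreover have "(\<lambda>k. log_series (s + of_real (\<epsilon> k))) \<longlonglongrightarrow> log_series s"
  proof (rule isCont_tendsto_compose[where g = log_series])
    show "isCont log_series s"
      using log_series_derivative(2)[OF s] DERIV_isCont by blast
    have "(\<lambda>k. s + of_real (\<epsilon> k)) \<longlonglongrightarrow> s + of_real 0"
      unfolding \<epsilon>_def by (intro tendsto_intros tendsto_inverse_Suc)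
    then show "(\<lambda>k. s + of_real (\<epsilon> k)) \<longlonglongrightarrow> s" by simp
  qed
  ultimately have "(LINT t|lborel. P t *\<^sub>R boundary_value log_series t) = log_series s"
    using LIMSEQ_unique by simp
  moreover have "integrable lborel (\<lambda>t. P t *\<^sub>R boundary_value log_series t)"
    by (rule integrable_dominated_convergence[OF meas w lim bound])
  ultimately show ?thesis by (simp add: has_bochner_integral_iff P_def)
qed

subsection \<open>Mean oscillation of the boundary values\<close>

text \<open>Fatou's lemma for mean squares. It serves twice: for partial sums at fixed
  \<open>\<epsilon>\<close>, and for \<open>\<epsilon>\<close> tending to 0.\<close>

lemma nn_integral_norm_squared_limit_le:
  fixes f :: "nat \<Rightarrow> real \<Rightarrow> complex"
  assumes [measurable]: "\<And>k. f k \<in> borel_measurable lborel" "S \<in> sets lborel"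
    and bound: "\<And>k. (\<integral>\<^sup>+t\<in>S. ennreal ((norm (f k t))\<^sup>2) \<partial>lborel) \<le> K"
    and lim: "AE t in lborel. (\<lambda>k. f k t) \<longlonglongrightarrow> g t"
  shows "(\<integral>\<^sup>+t\<in>S. ennreal ((norm (g t))\<^sup>2) \<partial>lborel) \<le> K"
proof -
  have "(\<integral>\<^sup>+t\<in>S. ennreal ((norm (g t))\<^sup>2) \<partial>lborel)
      = (\<integral>\<^sup>+t. liminf (\<lambda>k. ennreal ((norm (f k t))\<^sup>2) * indicator S t) \<partial>lborel)"
  proof (rule nn_integral_cong_AE)
    show "AE t in lborel. ennreal ((norm (g t))\<^sup>2) * indicator S t
        = liminf (\<lambda>k. ennreal ((norm (f k t))\<^sup>2) * indicator S t)"
      using lim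
    proof eventually_elim
      case (elim t)
      have "(\<lambda>k. ennreal ((norm (f k t))\<^sup>2)) \<longlonglongrightarrow> ennreal ((norm (g t))\<^sup>2)"
        by (intro tendsto_ennrealI tendsto_power tendsto_norm elim)
      then have "(\<lambda>k. ennreal ((norm (f k t))\<^sup>2) * indicator S t) \<longlonglongrightarrow> ennreal ((norm (g t))\<^sup>2) * indicator S t"
        by (cases "t \<in> S") auto
      from lim_imp_Liminf[OF _ this] show ?case by simp
    qed
  qed
  also have "\<dots> \<le> liminf (\<lambda>k. \<integral>\<^sup>+t\<in>S. ennreal ((norm (f k t))\<^sup>2) \<partial>lborel)"
    by (rule nn_integral_liminf) measurable
  also have "\<dots> \<le> limsup (\<lambda>k. \<integral>\<^sup>+t\<in>S. ennreal ((norm (f k t))\<^sup>2) \<partial>lborel)"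
    by (rule Liminf_le_Limsup) simp
  also have "\<dots> \<le> K"
    by (rule Limsup_bounded) (simp add: bound)
  finally show ?thesis .
qed

lemma continuous_on_log_term: "n \<ge> 2 \<Longrightarrow> continuous_on A (log_term n)"
  unfolding log_term_def by (auto simp: powr_def intro!: continuous_intros)

lemma coefficient_le:
  assumes "n \<ge> 2" "\<epsilon> \<ge> 0"
  shows "0 \<le> real n powr (-1 - \<epsilon>) / ln n" "real n powr (-1 - \<epsilon>) / ln n \<le> 1 / (n * ln n)"
proof -
  have "real n powr (-1 - \<epsilon>) \<le> real n powr (-1)" using assms by (intro powr_mono) auto
  also have "\<dots> = 1 / n" using assms by (simp add: powr_minus_divide)
  finally have "real n powr (-1 - \<epsilon>) / ln n \<le> (1 / n) / ln n" using assms by (intro divide_right_mono) auto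
  then show "real n powr (-1 - \<epsilon>) / ln n \<le> 1 / (n * ln n)" by simp
  show "0 \<le> real n powr (-1 - \<epsilon>) / ln n" using assms by simp
qed

section \<open>Low and high frequencies relative to a fixed interval\<close>

context
  fixes a b l c :: real and low :: "nat set"
  assumes ab: "a < b"
  defines "l \<equiv> b - a" and "c \<equiv> (a + b) / 2" and "low \<equiv> {n. 2 \<le> n \<and> (b - a) * ln (real n) \<le> 1}"
begin

lemma l_pos: "l > 0" using ab by (simp add: l_def)

lemma low_frequencies: "finite low" "low \<subseteq> {2..}" "\<And>n. n \<in> low \<Longrightarrow> l * ln (real n) \<le> 1"
proof -
  have "low \<subseteq> {n. real n \<le> exp (1 / l)}"
  proof
    fix n assume "n \<in> low"
    then have "ln (real n) \<le> 1 / l" "n \<ge> 2" using l_pos by (auto simp: low_def l_def field_simps)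
    then have "real n = exp (ln (real n))" "exp (ln (real n)) \<le> exp (1 / l)" by (simp, simp only: exp_le_cancel_iff)
    then show "n \<in> {n. real n \<le> exp (1 / l)}" by (simp only: mem_Collect_eq)
  qed
  moreover have "finite {n. real n \<le> exp (1 / l)}"
    by (rule finite_subset[of _ "{..nat \<lfloor>exp (1 / l)\<rfloor>}"]) (auto intro: le_nat_floor)
  ultimately show "finite low" by (rule finite_subset)
qed (auto simp: low_def l_def)

lemma high_partial_sum_le:
  assumes "\<epsilon> > 0" "finite A" "A \<subseteq> {2..}" "A \<inter> low = {}"
  shows "(\<integral>\<^sup>+t\<in>{a..b}. ennreal ((norm (\<Sum>n\<in>A. log_term n (Complex \<epsilon> t)))\<^sup>2) \<partial>lborel) \<le> ennreal (320 / 3 * pi * l)"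
proof -
  have *: "(\<Sum>n\<in>A. log_term n (Complex \<epsilon> t)) = (\<Sum>n\<in>A. of_real (real n powr (-1 - \<epsilon>) / ln n) * cis (- (ln n * t)))" for t
    using assms by (intro sum.cong refl log_term_Complex) auto
  have "{a..b} = {c - l / 2..c + l / 2}" by (simp add: c_def l_def field_simps)
  moreover have "(\<integral>\<^sup>+t\<in>{c - l / 2..c + l / 2}. ennreal ((norm (\<Sum>n\<in>A. log_term n (Complex \<epsilon> t)))\<^sup>2) \<partial>lborel)
      \<le> ennreal (320 / 3 * pi * l)"
    unfolding *
  proof (rule nn_integral_high_part_le[OF assms(2,3) l_pos])
    fix n assume n: "n \<in> A"
    then have n2: "n \<ge> 2" using assms by auto
    show "1 < l * ln (real n)"
      using assms n n2 by (force simp: low_def l_def)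
    show "0 \<le> real n powr (-1 - \<epsilon>) / ln n" "real n powr (-1 - \<epsilon>) / ln n \<le> 1 / (n * ln n)"
      using assms(1) by (auto intro!: coefficient_le[OF n2] simp del: divide_le_cancel)
  qed
  ultimately show ?thesis by (simp only:)
qed

lemma high_part_eps_le:
  assumes \<epsilon>: "\<epsilon> > 0"
  shows "(\<integral>\<^sup>+t\<in>{a..b}. ennreal ((norm (log_series (Complex \<epsilon> t) - (\<Sum>n\<in>low. log_term n (Complex \<epsilon> t))))\<^sup>2) \<partial>lborel)
        \<le> ennreal (320 / 3 * pi * l)"
proof (rule nn_integral_norm_squared_limit_le[where f = "\<lambda>N t. \<Sum>n\<in>{2..<N + 2} - low. log_term n (Complex \<epsilon> t)"])
  fix N
  have "continuous_on UNIV (\<lambda>t. \<Sum>n\<in>{2..<N + 2} - low. log_term n (Complex \<epsilon> t))"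
    by (intro continuous_on_sum continuous_on_compose2[OF continuous_on_log_term[of _ UNIV] continuous_on_Complex_right]) auto
  then show "(\<lambda>t. \<Sum>n\<in>{2..<N + 2} - low. log_term n (Complex \<epsilon> t)) \<in> borel_measurable lborel"
    using borel_measurable_continuous_onI by simp
  show "(\<integral>\<^sup>+t\<in>{a..b}. ennreal ((norm (\<Sum>n\<in>{2..<N + 2} - low. log_term n (Complex \<epsilon> t)))\<^sup>2) \<partial>lborel)
        \<le> ennreal (320 / 3 * pi * l)"
    by (rule high_partial_sum_le[OF \<epsilon>]) auto
next
  show "AE t in lborel. (\<lambda>N. \<Sum>n\<in>{2..<N + 2} - low. log_term n (Complex \<epsilon> t))
      \<longlonglongrightarrow> log_series (Complex \<epsilon> t) - (\<Sum>n\<in>low. log_term n (Complex \<epsilon> t))"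
  proof (rule AE_I2)
    fix t
    define f where "f n = log_term n (Complex \<epsilon> t)" for n
    have "(\<lambda>k. f (k + 2)) sums log_series (Complex \<epsilon> t)"
      unfolding f_def using \<epsilon> by (intro log_series_derivative) simp
    then have "(\<lambda>N. \<Sum>k<N. f (k + 2)) \<longlonglongrightarrow> log_series (Complex \<epsilon> t)" by (simp add: sums_def)
    then have "(\<lambda>N. (\<Sum>k<N. f (k + 2)) - sum f low) \<longlonglongrightarrow> log_series (Complex \<epsilon> t) - sum f low"
      by (intro tendsto_diff tendsto_const)
    \<comment> \<open>Once the range of summation contains all low indices, removing them from it
      amounts to subtracting their fixed sum.\<close>
    moreover have "\<forall>\<^sub>F N in sequentially. (\<Sum>k<N. f (k + 2)) - sum f low = sum f ({2..<N + 2} - low)"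
    proof -
      obtain M where M: "\<forall>n\<in>low. n \<le> M"
        using low_frequencies(1) finite_nat_set_iff_bounded_le by blast
      show ?thesis
        using eventually_ge_at_top[of M]
      proof eventually_elim
        case (elim N)
        have sub: "low \<subseteq> {2..<N + 2}" using M elim low_frequencies(2) by force
        have "(\<Sum>k<N. f (k + 2)) = sum f {2..<N + 2}"
          by (rule sum.reindex_bij_witness[of _ "\<lambda>n. n - 2" "\<lambda>k. k + 2"]) auto
        then show ?case by (simp only: sum_diff[OF finite_atLeastLessThan sub])
      qed
    qed
    ultimately show "(\<lambda>N. \<Sum>n\<in>{2..<N + 2} - low. log_term n (Complex \<epsilon> t))
      \<longlonglongrightarrow> log_series (Complex \<epsilon> t) - (\<Sum>n\<in>low. log_term n (Complex \<epsilon> t))"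
      unfolding f_def by (rule Lim_transform_eventually)
  qed
qed simp

lemma high_part_boundary_le:
  "(\<integral>\<^sup>+t\<in>{a..b}. ennreal ((norm (boundary_value log_series t - (\<Sum>n\<in>low. log_term n (Complex 0 t))))\<^sup>2) \<partial>lborel)
     \<le> ennreal (320 / 3 * pi * l)"
proof (rule nn_integral_norm_squared_limit_le[where f = "\<lambda>k t.
    log_series (Complex (1 / real (Suc k)) t) - (\<Sum>n\<in>low. log_term n (Complex (1 / real (Suc k)) t))"])
  fix k
  have "continuous_on UNIV (\<lambda>t. \<Sum>n\<in>low. log_term n (Complex (1 / real (Suc k)) t))"
    using low_frequencies(2)
    by (intro continuous_on_sum continuous_on_compose2[OF continuous_on_log_term[of _ UNIV] continuous_on_Complex_right]) auto
  then have "(\<lambda>t. \<Sum>n\<in>low. log_term n (Complex (1 / real (Suc k)) t)) \<in> borel_measurable lborel"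
    using borel_measurable_continuous_onI by simp
  then show "(\<lambda>t. log_series (Complex (1 / real (Suc k)) t) - (\<Sum>n\<in>low. log_term n (Complex (1 / real (Suc k)) t)))
      \<in> borel_measurable lborel"
    by (intro borel_measurable_diff log_series_vertical_measurable) auto
  show "(\<integral>\<^sup>+t\<in>{a..b}. ennreal ((norm (log_series (Complex (1 / real (Suc k)) t)
        - (\<Sum>n\<in>low. log_term n (Complex (1 / real (Suc k)) t))))\<^sup>2) \<partial>lborel) \<le> ennreal (320 / 3 * pi * l)"
    by (rule high_part_eps_le) simp
next
  show "AE t in lborel. (\<lambda>k. log_series (Complex (1 / real (Suc k)) t) - (\<Sum>n\<in>low. log_term n (Complex (1 / real (Suc k)) t)))
      \<longlonglongrightarrow> boundary_value log_series t - (\<Sum>n\<in>low. log_term n (Complex 0 t))"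
    using AE_nonzero
  proof eventually_elim
    case (elim t)
    have "(\<lambda>k. log_term n (Complex (1 / real (Suc k)) t)) \<longlonglongrightarrow> log_term n (Complex 0 t)" if "n \<in> low" for n
    proof (rule isCont_tendsto_compose[where g = "log_term n"])
      show "isCont (log_term n) (Complex 0 t)"
        using that low_frequencies(2) continuous_on_log_term[of n UNIV] by (auto simp: continuous_on_eq_continuous_at)
    qed (intro tendsto_Complex tendsto_inverse_Suc tendsto_const)
    then show ?case
      by (intro tendsto_diff tendsto_sum log_series_boundary_sequence elim)
  qed
qed simp

text \<open>The constant is the low part evaluated at the midpoint \<open>c\<close>: the low part
  stays within 1 of it on the interval, and the high part is small in mean square.\<close>

lemma boundary_oscillation_le:
  "\<exists>c0. (\<integral>\<^sup>+t\<in>{a..b}. ennreal (norm (boundary_value log_series t - c0)) \<partial>lborel)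
     \<le> ennreal ((2 + 320 / 3 * pi) * (b - a))"
proof
  define L where "L t = (\<Sum>n\<in>low. log_term n (Complex 0 t))" for t
  define v where "v = boundary_value log_series"
  have "continuous_on UNIV L" unfolding L_def
    using low_frequencies(2)
    by (intro continuous_on_sum continuous_on_compose2[OF continuous_on_log_term[of _ UNIV] continuous_on_Complex_right]) auto
  then have [measurable]: "L \<in> borel_measurable borel"
    by (rule borel_measurable_continuous_onI)
  have [measurable]: "v \<in> borel_measurable borel" unfolding v_def by measurable
  have L: "norm (L t - L c) \<le> 1" if "t \<in> {a..b}" for t
  proof -
    have *: "L t = (\<Sum>n\<in>low. of_real (real n powr (-1 - 0) / ln n) * cis (- (ln n * t)))" for t
      unfolding L_def using low_frequencies(2) by (intro sum.cong refl log_term_Complex) auto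
    have "norm (L t - L c) \<le> \<bar>t - c\<bar> / l"
      unfolding * using low_frequencies coefficient_le[where \<epsilon> = 0]
      by (intro low_part_oscillation l_pos) force+
    also have "\<bar>t - c\<bar> \<le> l" using that unfolding c_def l_def by (intro abs_leI) (auto simp: field_simps)
    then have "\<bar>t - c\<bar> / l \<le> 1" using l_pos by simp
    finally show ?thesis .
  qed
  \<comment> \<open>The inequality 2x \<le> 1 + x^2 takes the place of Cauchy-Schwarz, at no loss of
    order because the mean square of the high part is bounded by an absolute constant. The 2
    collects 1 from the low part and at most 1 from this inequality.\<close>
  have pt: "norm (v t - L c) \<le> 2 + (norm (v t - L t))\<^sup>2" if "t \<in> {a..b}" for t
  proof -
    have "norm (v t - L c) \<le> norm (v t - L t) + norm (L t - L c)"
      using norm_triangle_ineq[of "v t - L t" "L t - L c"] by simp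
    moreover have "2 * norm (v t - L t) \<le> 1 + (norm (v t - L t))\<^sup>2"
      using sum_squares_bound[of 1 "norm (v t - L t)"] by simp
    ultimately show ?thesis using L[OF that] zero_le_power2[of "norm (v t - L t)"] by linarith
  qed
  have "(\<integral>\<^sup>+t\<in>{a..b}. ennreal (norm (v t - L c)) \<partial>lborel)
      \<le> (\<integral>\<^sup>+t. ennreal 2 * indicator {a..b} t + ennreal ((norm (v t - L t))\<^sup>2) * indicator {a..b} t \<partial>lborel)"
  proof (rule nn_integral_mono)
    fix t
    show "ennreal (norm (v t - L c)) * indicator {a..b} t
       \<le> ennreal 2 * indicator {a..b} t + ennreal ((norm (v t - L t))\<^sup>2) * indicator {a..b} t"
      using ennreal_leI[OF pt[of t]] by (cases "t \<in> {a..b}") (auto simp: ennreal_plus)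
  qed
  also have "\<dots> = (\<integral>\<^sup>+t\<in>{a..b}. ennreal 2 \<partial>lborel) + (\<integral>\<^sup>+t\<in>{a..b}. ennreal ((norm (v t - L t))\<^sup>2) \<partial>lborel)"
    by (rule nn_integral_add) measurable
  also have "(\<integral>\<^sup>+t\<in>{a..b}. ennreal 2 \<partial>lborel) = ennreal 2 * ennreal l"
    using ab by (simp add: nn_integral_cmult_indicator l_def)
  also have "ennreal 2 * ennreal l = ennreal (2 * l)"
    using l_pos by (intro ennreal_mult[symmetric]) auto
  also have "ennreal (2 * l) + (\<integral>\<^sup>+t\<in>{a..b}. ennreal ((norm (v t - L t))\<^sup>2) \<partial>lborel)
      \<le> ennreal (2 * l) + ennreal (320 / 3 * pi * l)"
    unfolding v_def L_def by (intro add_left_mono high_part_boundary_le)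
  also have "\<dots> = ennreal (2 * l + 320 / 3 * pi * l)"
    using l_pos by (intro ennreal_plus[symmetric]) auto
  also have "\<dots> = ennreal ((2 + 320 / 3 * pi) * (b - a))" by (simp add: l_def distrib_right)
  finally show "(\<integral>\<^sup>+t\<in>{a..b}. ennreal (norm (boundary_value log_series t - L c)) \<partial>lborel)
     \<le> ennreal ((2 + 320 / 3 * pi) * (b - a))"
    unfolding v_def .
qed

end

text \<open>The mean lies within \<open>K\<close> of \<open>c0\<close>, so replacing
  \<open>c0\<close> by it costs a factor 2. Finiteness of the given integral makes \<open>f\<close>
  integrable on the interval, so \<open>interval_mean\<close> is the true mean and not the default
  value 0.\<close>

lemma mean_oscillation_le:
  assumes ab: "a < b" and [measurable]: "f \<in> borel_measurable borel" and K: "K \<ge> 0"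
    and le: "(\<integral>\<^sup>+t\<in>{a..b}. ennreal (norm (f t - c0)) \<partial>lborel) \<le> ennreal (K * (b - a))"
  shows "ennreal (1 / (b - a)) * (\<integral>\<^sup>+t\<in>{a..b}. ennreal (norm (f t - interval_mean f a b)) \<partial>lborel) \<le> ennreal (2 * K)"
proof -
  define m where "m = interval_mean f a b"
  have eq: "(\<integral>\<^sup>+t. ennreal (norm (indicator {a..b} t *\<^sub>R (f t - c0))) \<partial>lborel)
      = (\<integral>\<^sup>+t\<in>{a..b}. ennreal (norm (f t - c0)) \<partial>lborel)"
    by (intro nn_integral_cong) (auto simp: indicator_def)
  have d: "set_integrable lborel {a..b} (\<lambda>t. f t - c0)"
    unfolding set_integrable_def
  proof (rule integrableI_bounded)
    show "(\<integral>\<^sup>+t. ennreal (norm (indicator {a..b} t *\<^sub>R (f t - c0))) \<partial>lborel) < \<infinity>"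
      unfolding eq using le by (rule le_less_trans) simp
  qed measurable
  have const: "set_integrable lborel {a..b} (\<lambda>t. c0)"
    by (rule borel_integrable_atLeastAtMost') simp
  have "set_integrable lborel {a..b} (\<lambda>t. (f t - c0) + c0)"
    by (rule set_integral_add(1)[OF d const])
  then have f: "set_integrable lborel {a..b} f" by simp
  have "(LINT t:{a..b}|lborel. f t - c0) = (LINT t:{a..b}|lborel. f t) - (LINT t:{a..b}|lborel. c0)"
    by (rule set_integral_diff(2)[OF f const])
  also have "(LINT t:{a..b}|lborel. c0) = (b - a) *\<^sub>R c0"
    using ab by (simp add: set_lebesgue_integral_def)
  finally have mean: "m - c0 = (1 / (b - a)) *\<^sub>R (LINT t:{a..b}|lborel. f t - c0)"
    using ab by (simp add: m_def interval_mean_def scaleR_diff_right)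
  have "ennreal (norm (LINT t:{a..b}|lborel. f t - c0)) \<le> ennreal (K * (b - a))"
    using integral_norm_bound_ennreal[OF d[unfolded set_integrable_def]] le
    unfolding eq set_lebesgue_integral_def by (rule order_trans)
  then have "norm (LINT t:{a..b}|lborel. f t - c0) \<le> K * (b - a)"
    using ab K by (simp add: ennreal_le_iff)
  then have mc: "norm (m - c0) \<le> K"
    unfolding mean using ab by (simp add: field_simps)
  have "(\<integral>\<^sup>+t\<in>{a..b}. ennreal (norm (f t - m)) \<partial>lborel)
      \<le> (\<integral>\<^sup>+t. ennreal (norm (f t - c0)) * indicator {a..b} t + ennreal K * indicator {a..b} t \<partial>lborel)"
  proof (rule nn_integral_mono)
    fix t
    have "norm (f t - m) \<le> norm (f t - c0) + K"
      using norm_triangle_ineq4[of "f t - c0" "m - c0"] mc by simp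
    then show "ennreal (norm (f t - m)) * indicator {a..b} t
       \<le> ennreal (norm (f t - c0)) * indicator {a..b} t + ennreal K * indicator {a..b} t"
      using K by (auto simp: indicator_def simp flip: ennreal_plus intro: ennreal_leI)
  qed
  also have "\<dots> = (\<integral>\<^sup>+t\<in>{a..b}. ennreal (norm (f t - c0)) \<partial>lborel) + (\<integral>\<^sup>+t\<in>{a..b}. ennreal K \<partial>lborel)"
    by (rule nn_integral_add) measurable
  also have "\<dots> \<le> ennreal (K * (b - a)) + ennreal (K * (b - a))"
    using ab K by (intro add_mono le) (simp add: nn_integral_cmult_indicator ennreal_mult)
  also have "\<dots> = ennreal (2 * K * (b - a))"
    using ab K by (simp flip: ennreal_plus)
  finally have "ennreal (1 / (b - a)) * (\<integral>\<^sup>+t\<in>{a..b}. ennreal (norm (f t - m)) \<partial>lborel)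
      \<le> ennreal (1 / (b - a)) * ennreal (2 * K * (b - a))"
    by (rule mult_left_mono) simp
  also have "\<dots> = ennreal (2 * K)"
    using ab K by (simp flip: ennreal_mult)
  finally show ?thesis unfolding m_def .
qed

lemma bmo_norm_log_series: "bmo_norm (boundary_value log_series) < \<infinity>"
proof -
  have "bmo_norm (boundary_value log_series) \<le> ennreal (2 * (2 + 320 / 3 * pi))"
    unfolding bmo_norm_def
  proof (rule SUP_least, clarify)
    fix a b :: real assume ab: "a < b"
    obtain c0 where "(\<integral>\<^sup>+t\<in>{a..b}. ennreal (norm (boundary_value log_series t - c0)) \<partial>lborel)
       \<le> ennreal ((2 + 320 / 3 * pi) * (b - a))"
      using boundary_oscillation_le[OF ab] by blast
    then show "ennreal (1 / (b - a)) * (\<integral>\<^sup>+t\<in>{a..b}. ennreal (norm (boundary_value log_series t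
          - interval_mean (boundary_value log_series) a b)) \<partial>lborel) \<le> ennreal (2 * (2 + 320 / 3 * pi))"
      by (intro mean_oscillation_le[OF ab]) auto
  qed
  then show ?thesis by (rule le_less_trans) simp
qed

theorem theorem2p5:
  defines "a \<equiv> (\<lambda>(n::nat) (s::complex).
             1 / (of_nat n * of_real (ln (real n))) * of_nat n powr (- s))"
  shows "(\<forall>s\<in>right_half_plane. summable (\<lambda>k. a (k + 2) s)) \<and>
         (\<lambda>s. \<Sum>k. a (k + 2) s) \<in> BMOA"
proof
  have a: "a = log_term" by (simp add: a_def log_term_def fun_eq_iff)
  show "\<forall>s\<in>right_half_plane. summable (\<lambda>k. a (k + 2) s)"
    unfolding a right_half_plane_def using log_series_derivative(1) sums_summable by blast
  have "(\<lambda>s. \<Sum>k. a (k + 2) s) = log_series" by (simp add: a log_series_def fun_eq_iff)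
  \<comment> \<open>The exceptional set is the single point 0, where the logarithmic singularity
    sits.\<close>
  moreover have "AE t in lborel. \<exists>l. has_nontangential_limit log_series t l"
    using AE_nonzero by eventually_elim (use log_series_boundary(2) in blast)
  ultimately show "(\<lambda>s. \<Sum>k. a (k + 2) s) \<in> BMOA"
    using log_series_holomorphic log_series_poisson bmo_norm_log_series
    by (simp add: BMOA_def right_half_plane_def)
qed

end
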